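(* Let $\widetilde f$ be a generalized density on $\mathbb{R}$. Assume that $\widetilde f^{\ast n}\in\mathcal{S}_+$ for some $n\in\mathbb{N}$, and that $\widetilde f^{\ast n}$ is asymptotic to a non-increasing function (a.n.i.). If $\widetilde f^{\ast k}$, $k=1,\ldots,n-1$, are a.n.i., or if $\widetilde f\in\mathcal{L}$, then $\widetilde f\in\mathcal{S}$.
   Context: A generalized density is $\widetilde f(x)=p\,\delta(x)+q f(x)$ with $p+q=1$, $p,q\ge0$, where $f$ is an (ordinary) probability density on $\mathbb{R}$ and $\delta$ is the Dirac delta at $0$; it represents the measure $p\delta_0(dx)+qf(x)dx$. For $x\ne0$ its value is $qf(x)$. Convolution powers are convolutions of measures: $\widetilde f^{\ast n}=\sum_{k=0}^n\binom nk q^kp^{n-k}f^{\ast k}$ with $f^{\ast0}=\delta$, again a generalized density. The tail definitions below are applied to generalized densities through their values at $x\neq0$. Notation: $\mathbb{R}_+=[0,\infty)$; $\alpha(x)\sim\beta(x)$ means $\alpha(x)/\beta(x)\to1$ as $x\to\infty$. A (generalized) density $h$: - is long-tailed, $h\in\mathcal{L}$, if there is $x_0>0$ with $h(x)>0$ for $x\ge x_0$ and, for each fixed $y>0$, $h(x+y)\sim h(x)$; - is subexponential, $h\in\mathcal{S}$, if $h\in\mathcal{L}$ and $h^{\ast2}(x)\sim2h(x)$; - is weakly subexponential, $h\in\mathcal{S}_+$, if $h\in\mathcal{L}$ and its normalized restriction to $\mathbb{R}_+$ is in $\mathcal{S}$ (for an ordinary density with distribution function $H$ this is $h_+(x)=\mathbf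 1_{\mathbb{R}_+}(x)h(x)/(1-H(0))$; a generalized density $p\delta+qf$ with $q>0$ is in $\mathcal{S}_+$ iff its ordinary part $f$ is); - is a.n.i. if, for some $x_0>0$, $h$ is locally bounded and positive on $[x_0,\infty)$, and $\sup_{t\ge x}h(t)\sim h(x)$ and $\inf_{x_0\le t\le x}h(t)\sim h(x)$. *)

theory Defs
  imports "HOL-Probability.Probability"
begin

text \<open>
  The value \<open>GDensity p g\<close> stands for the measure \<open>p \<delta>\<^sub>0(dx) + g(x) dx\<close>, so that \<open>p \<delta> + q f\<close> is
  \<open>GDensity p (q f)\<close>: the weight of the absolutely continuous part is kept inside \<open>ac_part\<close>, which
  is therefore the value of the generalized density at every \<open>x \<noteq> 0\<close>. Ordinary densities are the
  case \<open>p = 0\<close>. Values are in \<open>ennreal\<close> because the convolution of two (finite-valued) densities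
  may well be infinite at some points.
\<close>

datatype gdensity = GDensity (atom: ennreal) (ac_part: "real \<Rightarrow> ennreal")

definition gmix :: "real \<Rightarrow> real \<Rightarrow> (real \<Rightarrow> real) \<Rightarrow> gdensity" where
  "gmix p q f = GDensity (ennreal p) (\<lambda>x. ennreal (q * f x))"

definition gconv :: "gdensity \<Rightarrow> gdensity \<Rightarrow> gdensity" where
  "gconv a b = GDensity (atom a * atom b)
     (\<lambda>x. atom a * ac_part b x + atom b * ac_part a x
          + (\<integral>\<^sup>+y. ac_part a (x - y) * ac_part b y \<partial>lborel))"

primrec gpow :: "gdensity \<Rightarrow> nat \<Rightarrow> gdensity" where
  "gpow h 0 = GDensity 1 (\<lambda>x. 0)"
| "gpow h (Suc n) = gconv (gpow h n) h"

text \<open>In \<open>ennreal\<close>, \<open>a / 0 = \<infinity>\<close> for \<open>a > 0\<close> and \<open>0 / 0 = a / \<infinity> = \<infinity> / \<infinity> = 0\<close>, so the limit below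
  forces both functions to be eventually positive and finite.\<close>

definition tail_equiv :: "(real \<Rightarrow> ennreal) \<Rightarrow> (real \<Rightarrow> ennreal) \<Rightarrow> bool" where
  "tail_equiv a b \<longleftrightarrow> ((\<lambda>x. a x / b x) \<longlongrightarrow> 1) at_top"

definition long_tailed :: "gdensity \<Rightarrow> bool" where
  "long_tailed h \<longleftrightarrow>
     (\<exists>x0>0. \<forall>x\<ge>x0. ac_part h x > 0) \<and>
     (\<forall>y>0. tail_equiv (\<lambda>x. ac_part h (x + y)) (ac_part h))"

definition subexponential :: "gdensity \<Rightarrow> bool" where
  "subexponential h \<longleftrightarrow>
     long_tailed h \<and> tail_equiv (ac_part (gpow h 2)) (\<lambda>x. 2 * ac_part h x)"

definition pos_restriction :: "(real \<Rightarrow> ennreal) \<Rightarrow> real \<Rightarrow> ennreal" where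
  "pos_restriction f x = indicator {0..} x * f x / ennreal (1 - cdf (density lborel f) 0)"

definition weakly_subexponential_density :: "(real \<Rightarrow> ennreal) \<Rightarrow> bool" where
  "weakly_subexponential_density f \<longleftrightarrow>
     long_tailed (GDensity 0 f) \<and> subexponential (GDensity 0 (pos_restriction f))"

definition ac_weight :: "gdensity \<Rightarrow> ennreal" where
  "ac_weight h = (\<integral>\<^sup>+x. ac_part h x \<partial>lborel)"

text \<open>A generalized density \<open>p \<delta> + q f\<close> is weakly subexponential iff \<open>q > 0\<close> and its ordinary part
  \<open>f\<close> is; \<open>f\<close> is recovered from \<open>q f\<close> by normalization.\<close>

definition weakly_subexponential :: "gdensity \<Rightarrow> bool" where
  "weakly_subexponential h \<longleftrightarrow>
     ac_weight h > 0 \<and> weakly_subexponential_density (\<lambda>x. ac_part h x / ac_weight h)"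

definition ani :: "gdensity \<Rightarrow> bool" where
  "ani h \<longleftrightarrow> (\<exists>x0>0.
     (\<forall>K. compact K \<and> K \<subseteq> {x0..} \<longrightarrow> (\<exists>M::real. \<forall>t\<in>K. ac_part h t \<le> ennreal M)) \<and>
     (\<forall>t\<ge>x0. ac_part h t > 0) \<and>
     tail_equiv (\<lambda>x. SUP t\<in>{x..}. ac_part h t) (ac_part h) \<and>
     tail_equiv (\<lambda>x. INF t\<in>{x0..x}. ac_part h t) (ac_part h))"

text \<open>
  The binomial expansion of the convolution powers. The summand \<open>k = 0\<close> vanishes here: it
  contributes only to the atom. With \<open>gmix_eq\<close> it applies to \<open>gmix p q f\<close>.
\<close>

lemma gmix_eq: "0 \<le> q \<Longrightarrow> gmix p q f = GDensity (ennreal p) (\<lambda>x. ennreal q * ennreal (f x))"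
  by (simp add: gmix_def ennreal_mult')

lemma gpow_measurable:
  assumes [measurable]: "ac_part h \<in> borel_measurable borel"
  shows "ac_part (gpow h n) \<in> borel_measurable borel"
proof (induction n)
  case (Suc n)
  note [measurable] = Suc.IH
  show ?case by (simp add: gconv_def)
qed simp

lemma atom_gpow: "atom (gpow h n) = atom h ^ n"
  by (induction n) (simp_all add: gconv_def mult.commute)

lemma gpow_binomial:
  fixes p q :: ennreal and f :: "real \<Rightarrow> ennreal"
  assumes [measurable]: "f \<in> borel_measurable borel"
  shows "ac_part (gpow (GDensity p (\<lambda>x. q * f x)) n) x =
    (\<Sum>k\<le>n. of_nat (n choose k) * q ^ k * p ^ (n - k) * ac_part (gpow (GDensity 0 f) k) x)"
proof (induction n arbitrary: x)
  case (Suc n)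
  define F where "F k = ac_part (gpow (GDensity 0 f) k)" for k
  have F0: "F 0 = (\<lambda>x. 0)"
    by (simp add: F_def fun_eq_iff)
  have [measurable]: "F k \<in> borel_measurable borel" for k
    unfolding F_def by (rule gpow_measurable) simp
  have F_Suc: "F (Suc k) x = (if k = 0 then f x else 0) + (\<integral>\<^sup>+y. F k (x - y) * f y \<partial>lborel)" for k x
    by (simp add: F_def gconv_def atom_gpow power_0_left)
  define c where "c n k = of_nat (n choose k) * q ^ k * p ^ (n - k)" for n k :: nat
  have IH: "ac_part (gpow (GDensity p (\<lambda>x. q * f x)) n) x = (\<Sum>k\<le>n. c n k * F k x)" for x
    using Suc.IH by (simp add: F_def c_def)
  have "(\<integral>\<^sup>+y. (\<Sum>k\<le>n. c n k * F k (x - y)) * (q * f y) \<partial>lborel)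
      = (\<integral>\<^sup>+y. (\<Sum>k\<le>n. c n k * q * (F k (x - y) * f y)) \<partial>lborel)"
    by (simp add: sum_distrib_left sum_distrib_right mult_ac)
  also have "\<dots> = (\<Sum>k\<le>n. c n k * q * (\<integral>\<^sup>+y. F k (x - y) * f y \<partial>lborel))"
    by (simp add: nn_integral_sum nn_integral_cmult)
  finally have "ac_part (gpow (GDensity p (\<lambda>x. q * f x)) (Suc n)) x
      = p ^ n * (q * f x) + p * (\<Sum>k\<le>n. c n k * F k x)
        + (\<Sum>k\<le>n. c n k * q * (\<integral>\<^sup>+y. F k (x - y) * f y \<partial>lborel))"
    by (simp add: gconv_def atom_gpow IH)
  also have "p ^ n * (q * f x) = (\<Sum>k\<le>n. c n k * q * (if k = 0 then f x else 0))"
    by (simp add: c_def if_distrib mult_ac cong: if_cong)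
  also have "(\<Sum>k\<le>n. c n k * q * (if k = 0 then f x else 0)) + p * (\<Sum>k\<le>n. c n k * F k x)
        + (\<Sum>k\<le>n. c n k * q * (\<integral>\<^sup>+y. F k (x - y) * f y \<partial>lborel))
      = p * (\<Sum>k\<le>n. c n k * F k x) + (\<Sum>k\<le>n. c n k * q * F (Suc k) x)"
    by (simp add: F_Suc distrib_left sum.distrib add_ac)
  also have "p * (\<Sum>k\<le>n. c n k * F k x) = (\<Sum>k\<le>n. p * c n (Suc k) * F (Suc k) x)"
  proof -
    have "(\<Sum>k\<le>n. p * c n (Suc k) * F (Suc k) x) = (\<Sum>k\<le>Suc n. p * c n k * F k x)"
      by (subst sum.atMost_Suc_shift) (simp add: F0)
    also have "\<dots> = (\<Sum>k\<le>n. p * c n k * F k x)"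
      by (simp add: c_def binomial_eq_0)
    finally show ?thesis by (simp add: sum_distrib_left mult_ac)
  qed
  also have "(\<Sum>k\<le>n. p * c n (Suc k) * F (Suc k) x) + (\<Sum>k\<le>n. c n k * q * F (Suc k) x)
      = (\<Sum>k\<le>n. c (Suc n) (Suc k) * F (Suc k) x)"
  proof -
    have "p * c n (Suc k) + c n k * q = c (Suc n) (Suc k)" if "k \<le> n" for k
    proof (cases "k = n")
      case False
      then have "n - k = Suc (n - Suc k)" using that by simp
      then show ?thesis by (simp add: c_def distrib_left distrib_right mult_ac add_ac)
    qed (simp add: c_def binomial_eq_0 mult_ac)
    then show ?thesis by (simp add: sum.distrib[symmetric] distrib_right[symmetric])
  qed
  also have "\<dots> = (\<Sum>k\<le>Suc n. c (Suc n) k * F k x)"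
    by (subst sum.atMost_Suc_shift) (simp add: F0)
  finally show ?case by (simp add: F_def c_def)
qed simp

text \<open>\<open>gconv\<close> is the convolution of the represented measures.\<close>

definition gmeasure :: "gdensity \<Rightarrow> real measure" where
  "gmeasure h = measure_of UNIV (sets borel)
     (\<lambda>A. atom h * indicator A 0 + emeasure (density lborel (ac_part h)) A)"

lemma sets_gmeasure[simp, measurable_cong]: "sets (gmeasure h) = sets borel"
  using sets.sigma_sets_eq[of "borel :: real measure"] by (simp add: gmeasure_def)

lemma space_gmeasure[simp]: "space (gmeasure h) = UNIV"
  by (simp add: gmeasure_def)

lemma emeasure_gmeasure:
  assumes "A \<in> sets borel"
  shows "emeasure (gmeasure h) A = atom h * indicator A 0 + emeasure (density lborel (ac_part h)) A"
proof (rule emeasure_measure_of[OF gmeasure_def])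
  show "countably_additive (sets (gmeasure h))
     (\<lambda>A. atom h * indicator A 0 + emeasure (density lborel (ac_part h)) A)"
  proof (rule countably_additiveI)
    fix A :: "nat \<Rightarrow> real set"
    assume A: "range A \<subseteq> sets (gmeasure h)" "disjoint_family A"
    have "(\<Sum>i. atom h * indicator (A i) 0 + emeasure (density lborel (ac_part h)) (A i))
        = atom h * (\<Sum>i. indicator (A i) 0) + (\<Sum>i. emeasure (density lborel (ac_part h)) (A i))"
      by (subst suminf_add[symmetric]) (auto simp: ennreal_suminf_cmult)
    also have "(\<Sum>i. indicator (A i) 0 :: ennreal) = indicator (\<Union>i. A i) 0"
      using A(2) by (rule suminf_indicator)
    also have "(\<Sum>i. emeasure (density lborel (ac_part h)) (A i))
        = emeasure (density lborel (ac_part h)) (\<Union>i. A i)"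
      using A by (intro suminf_emeasure) auto
    finally show "(\<Sum>i. atom h * indicator (A i) 0 + emeasure (density lborel (ac_part h)) (A i))
        = atom h * indicator (\<Union>i. A i) 0 + emeasure (density lborel (ac_part h)) (\<Union>i. A i)" .
  qed
qed (use assms in \<open>auto simp: positive_def\<close>)

lemma nn_integral_gmeasure:
  assumes [measurable]: "u \<in> borel_measurable borel" "ac_part h \<in> borel_measurable borel"
  shows "(\<integral>\<^sup>+x. u x \<partial>gmeasure h) = atom h * u 0 + (\<integral>\<^sup>+x. ac_part h x * u x \<partial>lborel)"
  using assms(1)
proof (induction rule: borel_measurable_induct)
  case (cong f g)
  then show ?case by (metis UNIV_I ext space_borel)
next
  case (set A)
  then show ?case by (simp add: emeasure_gmeasure emeasure_density)
next
  case (mult u c)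
  note [measurable] = mult(2)
  show ?case using mult
    by (simp add: nn_integral_cmult distrib_left mult.left_commute[of _ c])
next
  case (add u v)
  note [measurable] = add(1,3)
  show ?case using add
    by (simp add: nn_integral_add distrib_left add_ac)
next
  case (seq U)
  note [measurable] = seq(1)
  have inc: "incseq (\<lambda>i x. ac_part h x * U i x)"
    using seq(3) by (auto simp: incseq_def le_fun_def intro!: mult_left_mono)
  have "(\<integral>\<^sup>+x. (SUP i. U i) x \<partial>gmeasure h) = (SUP i. \<integral>\<^sup>+x. U i x \<partial>gmeasure h)"
    using seq(3) by (simp add: image_comp nn_integral_monotone_convergence_SUP)
  also have "\<dots> = (SUP i. atom h * U i 0 + (\<integral>\<^sup>+x. ac_part h x * U i x \<partial>lborel))"
    using seq by simp
  also have "\<dots> = (SUP i. atom h * U i 0) + (SUP i. \<integral>\<^sup>+x. ac_part h x * U i x \<partial>lborel)"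
    using seq(3) inc
    by (intro ennreal_SUP_add)
      (auto simp: incseq_def le_fun_def intro!: mult_left_mono nn_integral_mono)
  also have "(SUP i. \<integral>\<^sup>+x. ac_part h x * U i x \<partial>lborel)
      = (\<integral>\<^sup>+x. (SUP i. ac_part h x * U i x) \<partial>lborel)"
    using inc by (intro nn_integral_monotone_convergence_SUP[symmetric]) auto
  finally show ?case
    by (simp add: SUP_mult_left_ennreal image_comp)
qed

lemma gmeasure_gconv:
  assumes [measurable]: "ac_part a \<in> borel_measurable borel" "ac_part b \<in> borel_measurable borel"
    and fin: "finite_measure (gmeasure a)" "finite_measure (gmeasure b)"
  shows "gmeasure (gconv a b) = (gmeasure a \<star> gmeasure b)"
proof (rule measure_eqI)
  fix A assume "A \<in> sets (gmeasure (gconv a b))"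
  then have [measurable]: "A \<in> sets borel" by simp
  let ?f = "ac_part a" and ?g = "ac_part b" and ?i = "indicator A :: real \<Rightarrow> ennreal"
  have "emeasure (gmeasure a \<star> gmeasure b) A
      = (\<integral>\<^sup>+x. \<integral>\<^sup>+y. ?i (x + y) \<partial>gmeasure b \<partial>gmeasure a)"
    using fin by (simp add: convolution_emeasure')
  also have "\<dots> = (\<integral>\<^sup>+x. atom b * ?i x + (\<integral>\<^sup>+y. ?g y * ?i (x + y) \<partial>lborel) \<partial>gmeasure a)"
    by (simp add: nn_integral_gmeasure)
  also have "\<dots> = atom a * (atom b * ?i 0 + (\<integral>\<^sup>+y. ?g y * ?i y \<partial>lborel))
      + (\<integral>\<^sup>+x. ?f x * (atom b * ?i x + (\<integral>\<^sup>+y. ?g y * ?i (x + y) \<partial>lborel)) \<partial>lborel)"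
    by (subst nn_integral_gmeasure) simp_all
  also have "(\<integral>\<^sup>+x. ?f x * (atom b * ?i x + (\<integral>\<^sup>+y. ?g y * ?i (x + y) \<partial>lborel)) \<partial>lborel)
      = atom b * (\<integral>\<^sup>+x. ?f x * ?i x \<partial>lborel)
        + (\<integral>\<^sup>+x. \<integral>\<^sup>+y. ?f x * (?g y * ?i (x + y)) \<partial>lborel \<partial>lborel)"
    by (simp add: distrib_left nn_integral_add nn_integral_cmult[symmetric] mult_ac)
  also have "(\<integral>\<^sup>+x. \<integral>\<^sup>+y. ?f x * (?g y * ?i (x + y)) \<partial>lborel \<partial>lborel)
      = (\<integral>\<^sup>+y. \<integral>\<^sup>+x. ?f x * (?g y * ?i (x + y)) \<partial>lborel \<partial>lborel)"
    by (rule lborel_pair.Fubini') simp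
  also have "\<dots> = (\<integral>\<^sup>+y. \<integral>\<^sup>+x. ?f (x - y) * ?g y * ?i x \<partial>lborel \<partial>lborel)"
  proof (rule nn_integral_cong)
    fix y
    show "(\<integral>\<^sup>+x. ?f x * (?g y * ?i (x + y)) \<partial>lborel) = (\<integral>\<^sup>+x. ?f (x - y) * ?g y * ?i x \<partial>lborel)"
      by (subst nn_integral_real_affine[where c=1 and t="-y"]) (simp_all add: mult_ac)
  qed
  also have "\<dots> = (\<integral>\<^sup>+x. \<integral>\<^sup>+y. ?f (x - y) * ?g y * ?i x \<partial>lborel \<partial>lborel)"
    by (rule lborel_pair.Fubini') simp
  also have "\<dots> = (\<integral>\<^sup>+x. (\<integral>\<^sup>+y. ?f (x - y) * ?g y \<partial>lborel) * ?i x \<partial>lborel)"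
    by (simp add: nn_integral_multc)
  finally have "emeasure (gmeasure a \<star> gmeasure b) A
      = atom a * (atom b * ?i 0 + (\<integral>\<^sup>+y. ?g y * ?i y \<partial>lborel))
        + (atom b * (\<integral>\<^sup>+x. ?f x * ?i x \<partial>lborel)
        + (\<integral>\<^sup>+x. (\<integral>\<^sup>+y. ?f (x - y) * ?g y \<partial>lborel) * ?i x \<partial>lborel))" .
  then show "emeasure (gmeasure (gconv a b)) A = emeasure (gmeasure a \<star> gmeasure b) A"
    by (simp add: emeasure_gmeasure emeasure_density gconv_def distrib_left distrib_right
        nn_integral_add nn_integral_cmult[symmetric] mult_ac add_ac)
qed simp

end

theory Submission
  imports Defs
begin

text \<open>
  Let \<open>h\<close> be the generalized density and \<open>H\<close> the absolutely continuous part of its \<open>n\<close>-th convolution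
  power. All densities are compared with \<open>H\<close>: write \<open>u\<^sub>k = h\<^sub>k / H\<close>, where \<open>h\<^sub>k\<close> is the value of the
  \<open>k\<close>-th convolution power of \<open>h\<close>. It is enough to show that \<open>u\<^sub>1 \<rightarrow> 1 / n\<close> and \<open>u\<^sub>2 \<rightarrow> 2 / n\<close>: since
  \<open>H\<close> is long-tailed, so is then \<open>h\<close>, and \<open>h\<^sub>2\<close> is asymptotic to \<open>2 h\<^sub>1\<close>. Below, \<open>*\<close> between functions is
  convolution.

  Since \<open>H\<close> is weakly subexponential and a.n.i., the part of \<open>H * H\<close> in which both arguments exceed \<open>A\<close>
  is negligible against \<open>H\<close> for large \<open>A\<close> (\<open>subexp_tail_val\<close>). The same is true of \<open>a * b\<close> when \<open>a\<close> and
  \<open>b\<close> are dominated by \<open>H\<close>, so that \<open>a * b\<close> splits into two pieces, each with one argument at most \<open>A\<close>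
  (\<open>gconv_split\<close>). If \<open>a / H\<close> and \<open>b / H\<close> are moreover insensitive to shifts, then dominated
  convergence evaluates these pieces, and \<open>(a * b) / H - a / H - b / H \<rightarrow> 0\<close>
  (\<open>ratio_gconv_of_shift_insensitive\<close>). Hence, once \<open>h\<close> is dominated by \<open>H\<close> and
  \<open>u\<^sub>1\<close> is insensitive to shifts, induction gives \<open>u\<^sub>k - k u\<^sub>1 \<rightarrow> 0\<close> for all \<open>k\<close>, and \<open>u\<^sub>n = 1\<close> yields \<open>u\<^sub>1 \<rightarrow> 1 / n\<close>.

  If \<open>n = 1\<close>, then \<open>H = h\<close> and \<open>u\<^sub>1\<close> is eventually \<open>1\<close>. Otherwise \<open>h\<close> is dominated by \<open>H\<close>, being
  a convolution factor of it (\<open>bigO_of_factor\<close>). Insensitivity to shifts is clear if \<open>h\<close> is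
  long-tailed. If \<open>h\<close> and \<open>h\<^bsub>n - 1\<^esub>\<close> are a.n.i., then \<open>h\<^bsub>n - 1\<^esub>\<close> is dominated as well, and
  \<open>u\<^sub>1\<close> and \<open>u\<^bsub>n - 1\<^esub>\<close> are asymptotically decreasing. The decomposition of \<open>H = h * h\<^bsub>n - 1\<^esub>\<close>,
  divided by \<open>H\<close>, then writes the constant \<open>1\<close> as a sum of asymptotically decreasing terms up to a
  small error. None of these terms can drop, and this passes to \<open>u\<^sub>1\<close>
  (\<open>shift_insensitive_of_asymp_decreasing\<close>).
\<close>

section \<open>Real values and total mass\<close>

text \<open>
  The density as a real function. Points where the \<open>ennreal\<close> value is infinite are sent to \<open>0\<close>; for
  a probability they form a null set, and for the densities of interest they do not occur far out on
  the right.
\<close>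

definition val :: "gdensity \<Rightarrow> real \<Rightarrow> real" where
  "val g x = enn2real (ac_part g x)"

text \<open>The measurable generalized densities of total mass one.\<close>

definition prob_gdensity :: "gdensity \<Rightarrow> bool" where
  "prob_gdensity g \<longleftrightarrow> ac_part g \<in> borel_measurable borel \<and> atom g + ac_weight g = 1"

lemma val_nonneg [simp]: "0 \<le> val g x"
  by (simp add: val_def)

lemma prob_gdensity_measurable:
  "prob_gdensity g \<Longrightarrow> ac_part g \<in> borel_measurable borel"
  by (simp add: prob_gdensity_def)

lemma val_measurable:
  assumes "prob_gdensity g"
  shows "val g \<in> borel_measurable borel"
proof -
  have [measurable]: "ac_part g \<in> borel_measurable borel"
    using assms by (rule prob_gdensity_measurable)
  show ?thesis unfolding val_def[abs_def] by measurable
qed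

lemma ennreal_val: "ac_part g x < \<top> \<Longrightarrow> ennreal (val g x) = ac_part g x"
  by (simp add: val_def)

lemma AE_ennreal_val:
  assumes "prob_gdensity g"
  shows "AE x in lborel. ac_part g x = ennreal (val g x)"
proof -
  note [measurable] = prob_gdensity_measurable[OF assms]
  have "ac_weight g \<le> atom g + ac_weight g"
    by simp
  then have "(\<integral>\<^sup>+x. ac_part g x \<partial>lborel) \<noteq> \<infinity>"
    using assms by (auto simp: prob_gdensity_def ac_weight_def top_unique)
  then have "AE x in lborel. ac_part g x \<noteq> \<infinity>"
    by (intro nn_integral_PInf_AE) simp_all
  then show ?thesis
    by eventually_elim (simp add: ennreal_val top.not_eq_extremum)
qed

lemma val_integral:
  assumes "prob_gdensity g"
  shows "integrable lborel (val g)" and "enn2real (atom g) + (\<integral>x. val g x \<partial>lborel) = 1"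
    and "atom g = ennreal (enn2real (atom g))"
proof -
  note [measurable] = val_measurable[OF assms]
  have eq: "(\<integral>\<^sup>+x. ennreal (val g x) \<partial>lborel) = ac_weight g"
    unfolding ac_weight_def using AE_ennreal_val[OF assms]
    by (intro nn_integral_cong_AE) auto
  have sum: "atom g + ac_weight g = 1"
    using assms by (simp add: prob_gdensity_def)
  then have fin: "atom g < \<top>" "ac_weight g < \<top>"
    by (metis ennreal_add_eq_top ennreal_one_neq_top top.not_eq_extremum)+
  then show at: "atom g = ennreal (enn2real (atom g))"
    by simp
  show int: "integrable lborel (val g)"
    using fin eq by (intro integrableI_bounded) (simp_all add: infinity_ennreal_def)
  have "ennreal (\<integral>x. val g x \<partial>lborel) = ac_weight g"
    using nn_integral_eq_integral[OF int] eq by simp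
  then have "ennreal (enn2real (atom g) + (\<integral>x. val g x \<partial>lborel)) = 1"
    using sum at by (simp add: ennreal_plus)
  then show "enn2real (atom g) + (\<integral>x. val g x \<partial>lborel) = 1"
    by (simp del: ennreal_plus)
qed

lemma gconv_commute:
  assumes "prob_gdensity a" "prob_gdensity b"
  shows "gconv a b = gconv b a"
proof -
  note [measurable] = prob_gdensity_measurable[OF assms(1)] prob_gdensity_measurable[OF assms(2)]
  have "(\<integral>\<^sup>+y. ac_part a (x - y) * ac_part b y \<partial>lborel)
      = (\<integral>\<^sup>+y. ac_part b (x - y) * ac_part a y \<partial>lborel)" for x
    by (subst nn_integral_real_affine[where c="-1" and t=x]) (simp_all add: mult_ac)
  then show ?thesis
    by (simp add: gconv_def add_ac mult_ac)
qed

lemma prob_gdensity_gconv: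
  assumes "prob_gdensity a" "prob_gdensity b"
  shows "prob_gdensity (gconv a b)"
proof -
  let ?f = "ac_part a" and ?g = "ac_part b"
  note [measurable] = prob_gdensity_measurable[OF assms(1)] prob_gdensity_measurable[OF assms(2)]
  have "(\<integral>\<^sup>+x. \<integral>\<^sup>+y. ?f (x - y) * ?g y \<partial>lborel \<partial>lborel)
      = (\<integral>\<^sup>+y. \<integral>\<^sup>+x. ?f (x - y) * ?g y \<partial>lborel \<partial>lborel)"
    by (rule lborel_pair.Fubini') simp
  also have "\<dots> = (\<integral>\<^sup>+y. ac_weight a * ?g y \<partial>lborel)"
  proof (rule nn_integral_cong)
    fix y
    have "(\<integral>\<^sup>+x. ?f (x - y) \<partial>lborel) = ac_weight a"
      unfolding ac_weight_def
      by (subst (2) nn_integral_real_affine[where c=1 and t="-y"]) simp_all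
    then show "(\<integral>\<^sup>+x. ?f (x - y) * ?g y \<partial>lborel) = ac_weight a * ?g y"
      by (simp add: nn_integral_multc)
  qed
  also have "\<dots> = ac_weight a * ac_weight b"
    by (simp add: nn_integral_cmult ac_weight_def)
  finally have "atom (gconv a b) + ac_weight (gconv a b)
      = atom a * atom b + (atom a * ac_weight b + atom b * ac_weight a + ac_weight a * ac_weight b)"
    by (simp add: gconv_def ac_weight_def nn_integral_add nn_integral_cmult)
  also have "\<dots> = (atom a + ac_weight a) * (atom b + ac_weight b)"
    by (simp add: distrib_left distrib_right mult_ac add_ac)
  also have "\<dots> = 1"
    using assms by (simp add: prob_gdensity_def)
  finally show ?thesis
    by (simp add: prob_gdensity_def gconv_def)
qed

lemma prob_gdensity_gpow:
  assumes "prob_gdensity g"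
  shows "prob_gdensity (gpow g n)"
  by (induction n) (simp_all add: prob_gdensity_gconv assms, simp add: prob_gdensity_def ac_weight_def)

lemma gpow_1: "gpow g (Suc 0) = g"
  by (cases g) (simp add: gconv_def)

text \<open>
  The conventions for division in \<open>ennreal\<close> exclude the values \<open>0\<close> and \<open>\<infinity>\<close> far out on the right, so
  that tail equivalence is a statement about real functions there.
\<close>

lemma tail_equiv_val:
  "tail_equiv a b \<longleftrightarrow>
     (\<forall>\<^sub>F x in at_top. 0 < a x \<and> a x < \<top> \<and> 0 < b x \<and> b x < \<top>) \<and>
     ((\<lambda>x. enn2real (a x) / enn2real (b x)) \<longlongrightarrow> 1) at_top"
    (is "?L \<longleftrightarrow> ?fin \<and> ?R")
proof -
  have fin: ?fin if ?L
  proof -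
    from that have "\<forall>\<^sub>F x in at_top. 0 < a x / b x" "\<forall>\<^sub>F x in at_top. a x / b x < \<top>"
      by (auto simp: tail_equiv_def intro: order_tendstoD)
    then show ?thesis
    proof eventually_elim
      case (elim x)
      have "b x \<noteq> 0"
        using elim by (cases "a x = 0") (auto simp: ennreal_divide_zero)
      moreover have "b x \<noteq> \<top>" "a x \<noteq> 0"
        using elim by (auto simp: divide_ennreal_def)
      moreover from this have "a x \<noteq> \<top>"
        using elim by (auto simp: divide_ennreal_def ennreal_top_mult)
      ultimately show ?case
        by (simp add: zero_less_iff_neq_zero less_top)
    qed
  qed
  have "?L \<longleftrightarrow> ?R" if fin: ?fin
  proof -
    have ev: "\<forall>\<^sub>F x in at_top. a x / b x = ennreal (enn2real (a x) / enn2real (b x))"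
      using fin
    proof eventually_elim
      case (elim x)
      then show ?case
        by (cases "a x"; cases "b x") (auto simp: divide_ennreal)
    qed
    have "?L \<longleftrightarrow> ((\<lambda>x. ennreal (enn2real (a x) / enn2real (b x))) \<longlongrightarrow> ennreal 1) at_top"
      unfolding tail_equiv_def using tendsto_cong[OF ev] by simp
    also have "\<dots> \<longleftrightarrow> ?R"
      by (rule tendsto_ennreal_iff) simp_all
    finally show ?thesis .
  qed
  then show ?thesis
    using fin by blast
qed

section \<open>Functions that are insensitive to shifts or asymptotically decreasing\<close>

text \<open>
  The additive form of long-tailedness, suited to bounded functions that may tend to \<open>0\<close>.
\<close>

definition shift_insensitive :: "(real \<Rightarrow> real) \<Rightarrow> bool" where
  "shift_insensitive r \<longleftrightarrow> (\<forall>y. ((\<lambda>x. r (x - y) - r x) \<longlongrightarrow> 0) at_top)"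

text \<open>Nonincreasing up to an error that vanishes at infinity, for each fixed shift.\<close>

definition asymp_decreasing :: "(real \<Rightarrow> real) \<Rightarrow> bool" where
  "asymp_decreasing r \<longleftrightarrow> (\<forall>d\<ge>0. \<forall>\<epsilon>>0. \<forall>\<^sub>F x in at_top. r (x + d) \<le> r x + \<epsilon>)"

text \<open>
  The part of the convolution integral of \<open>a\<close> and \<open>b\<close> at \<open>x\<close> in which the argument of \<open>b\<close> is at most
  \<open>A\<close>.
\<close>

definition left_part :: "gdensity \<Rightarrow> gdensity \<Rightarrow> real \<Rightarrow> real \<Rightarrow> real" where
  "left_part a b A x = (\<integral>y. indicator {..A} y * val a (x - y) * val b y \<partial>lborel)"

lemma filterlim_shift: "filterlim (\<lambda>x::real. x - y) at_top at_top"
  by real_asymp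

lemma filterlim_shift': "filterlim (\<lambda>x::real. x + y) at_top at_top"
  by real_asymp

lemma shift_insensitiveI:
  assumes "\<And>c. c > 0 \<Longrightarrow> ((\<lambda>x. r x - r (x + c)) \<longlongrightarrow> 0) at_top"
  shows "shift_insensitive r"
  unfolding shift_insensitive_def
proof
  fix y :: real
  consider "y = 0" | "y > 0" | "y < 0" by linarith
  then show "((\<lambda>x. r (x - y) - r x) \<longlongrightarrow> 0) at_top"
  proof cases
    case 2
    show ?thesis
      using filterlim_compose[OF assms[OF 2] filterlim_shift[of y]] by simp
  next
    case 3
    then show ?thesis
      using tendsto_minus[OF assms[of "-y"]] by simp
  qed simp
qed

lemma shift_insensitive_of_convergent:
  assumes "(r \<longlongrightarrow> l) at_top"
  shows "shift_insensitive r"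
  unfolding shift_insensitive_def
proof
  fix y
  show "((\<lambda>x. r (x - y) - r x) \<longlongrightarrow> 0) at_top"
    using tendsto_diff[OF filterlim_compose[OF assms filterlim_shift[of y]] assms] by simp
qed

lemma shift_insensitive_of_cmult:
  assumes "shift_insensitive r" "((\<lambda>x. s x - c * r x) \<longlongrightarrow> 0) at_top"
  shows "shift_insensitive s"
  unfolding shift_insensitive_def
proof
  fix y
  have "((\<lambda>x. c * (r (x - y) - r x)) \<longlongrightarrow> 0) at_top"
    using assms(1) by (auto simp: shift_insensitive_def intro: tendsto_mult_right_zero)
  from tendsto_add[OF tendsto_diff[OF filterlim_compose[OF assms(2) filterlim_shift[of y]] assms(2)] this]
  show "((\<lambda>x. s (x - y) - s x) \<longlongrightarrow> 0) at_top"
    by (simp add: algebra_simps)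
qed

section \<open>Convolution relative to a subexponential reference function\<close>

text \<open>
  A reference function \<open>H\<close> with the tail behaviour of an a.n.i. subexponential density. Besides
  long-tailedness (\<open>H_shift\<close>), only two consequences are needed: \<open>H\<close> is decreasing up to a constant
  (\<open>H_ani\<close>), and the part of \<open>H * H\<close> in which both arguments exceed \<open>A\<close> is negligible against \<open>H\<close>
  for large \<open>A\<close> (\<open>H_small\<close>).
\<close>

locale subexp_tail =
  fixes H :: "real \<Rightarrow> real"
  assumes H_measurable [measurable]: "H \<in> borel_measurable borel"
    and H_nonneg: "\<And>x. 0 \<le> H x"
    and H_pos: "\<forall>\<^sub>F x in at_top. 0 < H x"
    and H_shift: "\<And>y. ((\<lambda>x. H (x - y) / H x) \<longlongrightarrow> 1) at_top"
    and H_ani: "\<exists>K>0. \<forall>\<^sub>F x in at_top. \<forall>t\<ge>x. H t \<le> K * H x"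
    and H_small: "\<And>\<epsilon>. 0 < \<epsilon> \<Longrightarrow> \<forall>\<^sub>F A in at_top. \<forall>\<^sub>F x in at_top.
      (\<integral>\<^sup>+y. indicator {A<..<x - A} y * ennreal (H (x - y) * H y) \<partial>lborel) \<le> ennreal (\<epsilon> * H x)"
begin

text \<open>
  Domination by \<open>H\<close> in the tail; it entails that the density is finite there.
\<close>

definition bigO :: "gdensity \<Rightarrow> bool" where
  "bigO a \<longleftrightarrow> (\<exists>C>0. \<forall>\<^sub>F x in at_top. ac_part a x \<le> ennreal (C * H x))"

definition ratio :: "gdensity \<Rightarrow> real \<Rightarrow> real" where
  "ratio a x = val a x / H x"

lemma ratio_nonneg: "0 \<le> ratio a x"
  by (simp add: ratio_def H_nonneg)

lemma val_le: "ac_part a x \<le> ennreal c \<Longrightarrow> 0 \<le> c \<Longrightarrow> val a x \<le> c"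
  unfolding val_def by (rule enn2real_leI)

lemma val_eq_ratio: "\<forall>\<^sub>F x in at_top. val a x = ratio a x * H x"
  using H_pos by eventually_elim (simp add: ratio_def)

lemma bigO_finite:
  assumes "bigO a"
  shows "\<forall>\<^sub>F x in at_top. ac_part a x < \<top>"
proof -
  from assms obtain C where "\<forall>\<^sub>F x in at_top. ac_part a x \<le> ennreal (C * H x)"
    by (auto simp: bigO_def)
  then show ?thesis
    by eventually_elim (metis ennreal_less_top le_less_trans)
qed

lemma bigO_ratio:
  assumes "bigO a"
  shows "\<exists>C>0. \<forall>\<^sub>F x in at_top. ratio a x \<le> C"
proof -
  from assms obtain C where C: "C > 0" "\<forall>\<^sub>F x in at_top. ac_part a x \<le> ennreal (C * H x)"
    by (auto simp: bigO_def)
  have "\<forall>\<^sub>F x in at_top. ratio a x \<le> C"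
    using C(2) H_pos
  proof eventually_elim
    case (elim x)
    then have "val a x \<le> C * H x"
      using C(1) by (intro val_le) auto
    then show ?case
      using elim by (simp add: ratio_def divide_le_eq)
  qed
  then show ?thesis using C(1) by blast
qed

lemma bigOI_ratio:
  assumes "\<forall>\<^sub>F x in at_top. ac_part a x < \<top>" and "\<forall>\<^sub>F x in at_top. ratio a x \<le> C"
  shows "bigO a"
  unfolding bigO_def
proof (intro exI conjI)
  show "0 < \<bar>C\<bar> + 1" by simp
  show "\<forall>\<^sub>F x in at_top. ac_part a x \<le> ennreal ((\<bar>C\<bar> + 1) * H x)"
    using assms H_pos
  proof eventually_elim
    case (elim x)
    then have "val a x \<le> C * H x"
      by (simp add: ratio_def divide_le_eq)
    also have "\<dots> \<le> (\<bar>C\<bar> + 1) * H x"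
      using elim by (intro mult_right_mono) auto
    finally have "ennreal (val a x) \<le> ennreal ((\<bar>C\<bar> + 1) * H x)"
      by (rule ennreal_leI)
    then show ?case
      using elim by (simp add: ennreal_val)
  qed
qed

text \<open>
  The bound that makes dominated convergence applicable to the left parts: \<open>a (x - y)\<close> is dominated
  by \<open>H x\<close> uniformly in \<open>y \<le> A\<close>, however negative \<open>y\<close> is.
\<close>

lemma left_bound:
  assumes "bigO a"
  shows "\<exists>M>0. \<forall>\<^sub>F x in at_top. \<forall>y\<le>A. ac_part a (x - y) \<le> ennreal (M * H x)"
proof -
  from assms obtain C where C: "C > 0" "\<forall>\<^sub>F x in at_top. ac_part a x \<le> ennreal (C * H x)"
    by (auto simp: bigO_def)
  from H_ani obtain K where K: "K > 0" "\<forall>\<^sub>F x in at_top. \<forall>t\<ge>x. H t \<le> K * H x"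
    by blast
  from C(2) obtain X where X: "\<And>x. x \<ge> X \<Longrightarrow> ac_part a x \<le> ennreal (C * H x)"
    by (auto simp: eventually_at_top_linorder)
  have K': "\<forall>\<^sub>F x in at_top. \<forall>t\<ge>x - A. H t \<le> K * H (x - A)"
    by (rule eventually_compose_filterlim[OF K(2) filterlim_shift])
  have 2: "\<forall>\<^sub>F x in at_top. H (x - A) / H x < 2"
    by (rule order_tendstoD[OF H_shift]) simp
  have "\<forall>\<^sub>F x in at_top. \<forall>y\<le>A. ac_part a (x - y) \<le> ennreal ((2 * C * K) * H x)"
    using K' 2 H_pos eventually_ge_at_top[of "X + A"]
  proof eventually_elim
    case (elim x)
    show ?case
    proof (intro allI impI)
      fix y assume "y \<le> A"
      then have "ac_part a (x - y) \<le> ennreal (C * H (x - y))"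
        using elim by (intro X) auto
      also have "\<dots> \<le> ennreal (2 * C * K * H x)"
      proof (rule ennreal_leI)
        have "C * H (x - y) \<le> C * (K * (2 * H x))"
        proof (intro mult_left_mono)
          have "H (x - y) \<le> K * H (x - A)"
            using elim \<open>y \<le> A\<close> by auto
          also have "\<dots> \<le> K * (2 * H x)"
            using elim K(1) by (intro mult_left_mono) (simp_all add: divide_less_eq)
          finally show "H (x - y) \<le> K * (2 * H x)" .
        qed (use C(1) in simp)
        then show "C * H (x - y) \<le> 2 * C * K * H x"
          by (simp add: mult_ac)
      qed
      finally show "ac_part a (x - y) \<le> ennreal (2 * C * K * H x)" .
    qed
  qed
  moreover have "2 * C * K > 0" using C K by simp
  ultimately show ?thesis by blast
qed

lemma left_integrable:
  assumes "bigO a" "prob_gdensity a" "prob_gdensity b"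
  shows "\<forall>\<^sub>F x in at_top. integrable lborel (\<lambda>y. indicator {..A} y * val a (x - y) * val b y)"
    and "\<forall>\<^sub>F x in at_top. (\<integral>\<^sup>+y. indicator {..A} y * (ac_part a (x - y) * ac_part b y) \<partial>lborel)
       = ennreal (left_part a b A x)"
proof -
  note [measurable] = val_measurable[OF assms(2)] val_measurable[OF assms(3)]
    prob_gdensity_measurable[OF assms(2)] prob_gdensity_measurable[OF assms(3)]
  obtain M where M: "M > 0"
    "\<forall>\<^sub>F x in at_top. \<forall>y\<le>A. ac_part a (x - y) \<le> ennreal (M * H x)"
    using left_bound[OF assms(1)] by blast
  have int: "integrable lborel (\<lambda>y. indicator {..A} y * val a (x - y) * val b y)"
    if x: "\<forall>y\<le>A. ac_part a (x - y) \<le> ennreal (M * H x)" for x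
  proof (rule Bochner_Integration.integrable_bound)
    show "integrable lborel (\<lambda>y. M * H x * val b y)"
      using val_integral(1)[OF assms(3)] by simp
    show "AE y in lborel. norm (indicator {..A} y * val a (x - y) * val b y) \<le> norm (M * H x * val b y)"
    proof (rule AE_I2)
      fix y
      have "val a (x - y) \<le> M * H x" if "y \<le> A"
        using x that M(1) H_nonneg by (intro val_le) auto
      then show "norm (indicator {..A} y * val a (x - y) * val b y) \<le> norm (M * H x * val b y)"
        using M(1) H_nonneg[of x] by (auto simp: indicator_def abs_mult intro!: mult_right_mono)
    qed
  qed simp
  show "\<forall>\<^sub>F x in at_top. integrable lborel (\<lambda>y. indicator {..A} y * val a (x - y) * val b y)"
    using M(2) by eventually_elim (rule int)
  show "\<forall>\<^sub>F x in at_top. (\<integral>\<^sup>+y. indicator {..A} y * (ac_part a (x - y) * ac_part b y) \<partial>lborel)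
       = ennreal (left_part a b A x)"
    using M(2)
  proof eventually_elim
    case (elim x)
    have "(\<integral>\<^sup>+y. indicator {..A} y * (ac_part a (x - y) * ac_part b y) \<partial>lborel)
      = (\<integral>\<^sup>+y. ennreal (indicator {..A} y * val a (x - y) * val b y) \<partial>lborel)"
    proof (rule nn_integral_cong_AE)
      show "AE y in lborel. indicator {..A} y * (ac_part a (x - y) * ac_part b y)
        = ennreal (indicator {..A} y * val a (x - y) * val b y)"
        using AE_ennreal_val[OF assms(3)]
      proof eventually_elim
        case (elim y)
        show ?case
        proof (cases "y \<le> A")
          case True
          then have "ac_part a (x - y) < \<top>"
            using \<open>\<forall>y\<le>A. _\<close> by (metis ennreal_less_top le_less_trans)
          then show ?thesis
            using True by (simp add: elim[symmetric] ennreal_val ennreal_mult)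
        qed simp
      qed
    qed
    also have "\<dots> = ennreal (left_part a b A x)"
      unfolding left_part_def by (rule nn_integral_eq_integral[OF int[OF elim]]) simp
    finally show ?case .
  qed
qed

lemma left_part_nonneg: "0 \<le> left_part a b A x"
  unfolding left_part_def by simp

text \<open>
  Only one big argument matters: up to an error \<open>\<epsilon> * H x\<close>, the convolution consists of the atomic
  terms and of the two parts of the integral in which one argument is at most \<open>A\<close>.
\<close>

lemma gconv_split:
  assumes a: "prob_gdensity a" "bigO a" and b: "prob_gdensity b" "bigO b" and "\<epsilon> > 0"
  shows "\<forall>\<^sub>F A in at_top. \<forall>\<^sub>F x in at_top. ac_part (gconv a b) x < \<top> \<and>
    \<bar>val (gconv a b) x - (enn2real (atom a) * val b x + enn2real (atom b) * val a x
      + left_part a b A x + left_part b a A x)\<bar> \<le> \<epsilon> * H x"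
proof -
  note [measurable] = prob_gdensity_measurable[OF a(1)] prob_gdensity_measurable[OF b(1)]
  let ?f = "ac_part a" and ?g = "ac_part b"
  obtain C where C: "C > 0" "\<forall>\<^sub>F x in at_top. ?f x \<le> ennreal (C * H x)"
    using a by (auto simp: bigO_def)
  obtain D where D: "D > 0" "\<forall>\<^sub>F x in at_top. ?g x \<le> ennreal (D * H x)"
    using b by (auto simp: bigO_def)
  obtain X where X: "\<And>x. x \<ge> X \<Longrightarrow> ?f x \<le> ennreal (C * H x)"
    "\<And>x. x \<ge> X \<Longrightarrow> ?g x \<le> ennreal (D * H x)"
    using eventually_conj[OF C(2) D(2)] by (auto simp: eventually_at_top_linorder)
  have "\<epsilon> / (C * D) > 0" using \<open>\<epsilon> > 0\<close> C D by simp
  from H_small[OF this] eventually_ge_at_top[of X]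
  show ?thesis
  proof eventually_elim
    case (elim A)
    let ?mid = "\<lambda>x. \<integral>\<^sup>+y. indicator {A<..<x - A} y * (?f (x - y) * ?g y) \<partial>lborel"
    show ?case
      using elim(1) left_integrable(2)[OF a(2,1) b(1), of A] left_integrable(2)[OF b(2,1) a(1), of A]
        bigO_finite[OF a(2)] bigO_finite[OF b(2)] eventually_gt_at_top[of "2 * A"]
    proof eventually_elim
      case (elim x)
      have mid: "?mid x \<le> ennreal (\<epsilon> * H x)"
      proof -
        have "?mid x \<le> (\<integral>\<^sup>+y. ennreal (C * D) *
            (indicator {A<..<x - A} y * ennreal (H (x - y) * H y)) \<partial>lborel)"
        proof (rule nn_integral_mono)
          fix y
          have "?f (x - y) * ?g y \<le> ennreal (C * D) * ennreal (H (x - y) * H y)"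
            if "A < y" "y < x - A"
          proof -
            have "?f (x - y) * ?g y \<le> ennreal (C * H (x - y)) * ennreal (D * H y)"
              using that \<open>X \<le> A\<close> by (intro mult_mono X) auto
            also have "\<dots> = ennreal (C * D) * ennreal (H (x - y) * H y)"
              using C D H_nonneg by (simp add: ennreal_mult mult_ac)
            finally show ?thesis .
          qed
          then show "indicator {A<..<x - A} y * (?f (x - y) * ?g y)
            \<le> ennreal (C * D) * (indicator {A<..<x - A} y * ennreal (H (x - y) * H y))"
            by (auto simp: indicator_def)
        qed
        also have "\<dots> = ennreal (C * D) *
            (\<integral>\<^sup>+y. indicator {A<..<x - A} y * ennreal (H (x - y) * H y) \<partial>lborel)"
          by (rule nn_integral_cmult) simp
        also have "\<dots> \<le> ennreal (C * D) * ennreal (\<epsilon> / (C * D) * H x)"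
          by (intro mult_left_mono elim) simp
        also have "\<dots> = ennreal (\<epsilon> * H x)"
          using C D \<open>\<epsilon> > 0\<close> H_nonneg by (simp flip: ennreal_mult)
        finally show ?thesis .
      qed
      have "(\<integral>\<^sup>+y. ?f (x - y) * ?g y \<partial>lborel)
        = (\<integral>\<^sup>+y. indicator {..A} y * (?f (x - y) * ?g y) + indicator {x - A..} y * (?f (x - y) * ?g y)
            + indicator {A<..<x - A} y * (?f (x - y) * ?g y) \<partial>lborel)"
        using elim by (intro nn_integral_cong) (auto simp: indicator_def)
      also have "\<dots> = (\<integral>\<^sup>+y. indicator {..A} y * (?f (x - y) * ?g y) \<partial>lborel)
         + (\<integral>\<^sup>+y. indicator {x - A..} y * (?f (x - y) * ?g y) \<partial>lborel) + ?mid x"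
        by (simp add: nn_integral_add)
      also have "(\<integral>\<^sup>+y. indicator {x - A..} y * (?f (x - y) * ?g y) \<partial>lborel)
        = (\<integral>\<^sup>+y. indicator {..A} y * (?g (x - y) * ?f y) \<partial>lborel)"
        by (subst nn_integral_real_affine[where c="-1" and t=x])
          (auto simp: indicator_def mult_ac intro!: nn_integral_cong)
      finally have eq: "ac_part (gconv a b) x = atom a * ?g x + atom b * ?f x
         + (ennreal (left_part a b A x) + ennreal (left_part b a A x) + ?mid x)"
        using elim by (simp add: gconv_def)
      have fin: "?mid x < \<top>"
        using mid by (metis ennreal_less_top le_less_trans)
      have m: "enn2real (?mid x) \<le> \<epsilon> * H x"
        using mid \<open>\<epsilon> > 0\<close> H_nonneg by (intro enn2real_leI) auto
      have fin2: "ac_part (gconv a b) x = ennreal (enn2real (atom a) * val b x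
         + enn2real (atom b) * val a x
         + (left_part a b A x + left_part b a A x + enn2real (?mid x)))"
      proof -
        have 1: "atom a * ?g x = ennreal (enn2real (atom a) * val b x)"
          by (subst val_integral(3)[OF a(1)]) (simp add: ennreal_mult ennreal_val elim)
        have 2: "atom b * ?f x = ennreal (enn2real (atom b) * val a x)"
          by (subst val_integral(3)[OF b(1)]) (simp add: ennreal_mult ennreal_val elim)
        have 3: "?mid x = ennreal (enn2real (?mid x))"
          using fin by simp
        show ?thesis
          unfolding eq 1 2 by (subst 3) (simp add: left_part_nonneg)
      qed
      then have "val (gconv a b) x = enn2real (atom a) * val b x + enn2real (atom b) * val a x
         + (left_part a b A x + left_part b a A x + enn2real (?mid x))"
        unfolding val_def[of "gconv a b"] by (simp add: left_part_nonneg del: ennreal_plus)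
      then show ?case
        using m fin2 by simp
    qed
  qed
qed

lemma H_shift_inv: "((\<lambda>x. H x / H (x + d)) \<longlongrightarrow> 1) at_top"
  using filterlim_compose[OF H_shift[of d] filterlim_shift'[of d]] by simp

lemma bigO_ratio_shift:
  assumes "bigO a"
  shows "\<exists>C>0. \<forall>y. \<forall>\<^sub>F x in at_top. ratio a (x - y) \<le> C"
proof -
  obtain C where "C > 0" "\<forall>\<^sub>F x in at_top. ratio a x \<le> C"
    using bigO_ratio[OF assms] by blast
  then show ?thesis
    by (auto intro!: exI[of _ C] eventually_compose_filterlim[OF _ filterlim_shift])
qed

text \<open>Normalizing by \<open>H x\<close> instead of \<open>H (x - y)\<close> is harmless.\<close>

lemma val_shift:
  assumes "bigO a"
  shows "((\<lambda>x. val a (x - y) / H x - ratio a (x - y)) \<longlongrightarrow> 0) at_top"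
proof -
  obtain C where C: "C > 0" "\<forall>\<^sub>F x in at_top. ratio a (x - y) \<le> C"
    using bigO_ratio_shift[OF assms] by blast
  have "((\<lambda>x. C * \<bar>H (x - y) / H x - 1\<bar>) \<longlongrightarrow> C * \<bar>1 - 1\<bar>) at_top"
    by (intro tendsto_intros H_shift)
  then have lim: "((\<lambda>x. C * \<bar>H (x - y) / H x - 1\<bar>) \<longlongrightarrow> 0) at_top"
    by simp
  have "\<forall>\<^sub>F x in at_top. norm (val a (x - y) / H x - ratio a (x - y)) \<le> C * \<bar>H (x - y) / H x - 1\<bar>"
    using C(2) H_pos eventually_compose_filterlim[OF val_eq_ratio filterlim_shift, of a y]
  proof eventually_elim
    case (elim x)
    have "val a (x - y) / H x - ratio a (x - y) = ratio a (x - y) * (H (x - y) / H x - 1)"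
      using elim by (simp add: field_simps)
    then have "norm (val a (x - y) / H x - ratio a (x - y))
        = ratio a (x - y) * \<bar>H (x - y) / H x - 1\<bar>"
      by (simp add: abs_mult ratio_nonneg)
    also have "\<dots> \<le> C * \<bar>H (x - y) / H x - 1\<bar>"
      using elim by (intro mult_right_mono) auto
    finally show ?case .
  qed
  from Lim_null_comparison[OF this lim] show ?thesis .
qed

lemma left_bound_val:
  assumes "bigO a"
  shows "\<exists>M>0. \<forall>\<^sub>F x in at_top. \<forall>y\<le>A. val a (x - y) / H x \<le> M"
proof -
  obtain M where M: "M > 0"
    "\<forall>\<^sub>F x in at_top. \<forall>y\<le>A. ac_part a (x - y) \<le> ennreal (M * H x)"
    using left_bound[OF assms] by blast
  have "\<forall>\<^sub>F x in at_top. \<forall>y\<le>A. val a (x - y) / H x \<le> M"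
    using M(2) H_pos
  proof eventually_elim
    case (elim x)
    have "val a (x - y) \<le> M * H x" if "y \<le> A" for y
      using elim that M(1) by (intro val_le) auto
    then show ?case
      using elim by (simp add: divide_le_eq)
  qed
  then show ?thesis using M(1) by blast
qed

lemma left_part_shift_insensitive:
  assumes a: "prob_gdensity a" "bigO a" "shift_insensitive (ratio a)" and b: "prob_gdensity b"
  shows "((\<lambda>x. left_part a b A x / H x - ratio a x * (\<integral>y. indicator {..A} y * val b y \<partial>lborel))
    \<longlongrightarrow> 0) at_top"
proof -
  note [measurable] = val_measurable[OF a(1)] val_measurable[OF b]
  have int_b: "integrable lborel (\<lambda>y. indicator {..A} y * val b y)"
    using integrable_mult_indicator[OF _ val_integral(1)[OF b], of "{..A}"] by simp
  obtain M where M: "M > 0" "\<forall>\<^sub>F x in at_top. \<forall>y\<le>A. val a (x - y) / H x \<le> M"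
    using left_bound_val[OF a(2)] by blast
  obtain C where C: "C > 0" "\<forall>\<^sub>F x in at_top. ratio a x \<le> C"
    using bigO_ratio[OF a(2)] by blast
  define s where "s x y = (val a (x - y) / H x - ratio a x) * (indicator {..A} y * val b y)" for x y
  have "((\<lambda>x. \<integral>y. s x y \<partial>lborel) \<longlongrightarrow> integral\<^sup>L lborel (\<lambda>y::real. 0)) at_top"
  proof (rule integral_dominated_convergence_at_top)
    show "integrable lborel (\<lambda>y. (M + C) * (indicator {..A} y * val b y))"
      by (intro integrable_mult_right int_b)
    show "s x \<in> borel_measurable lborel" for x
      unfolding s_def by measurable
    show "AE y in lborel. ((\<lambda>x. s x y) \<longlongrightarrow> 0) at_top"
    proof (rule AE_I2)
      fix y
      have "((\<lambda>x. ratio a (x - y) - ratio a x) \<longlongrightarrow> 0) at_top"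
        using a(3) by (simp add: shift_insensitive_def)
      from tendsto_add[OF val_shift[OF a(2), of y] this]
      have "((\<lambda>x. val a (x - y) / H x - ratio a x) \<longlongrightarrow> 0) at_top"
        by simp
      then show "((\<lambda>x. s x y) \<longlongrightarrow> 0) at_top"
        unfolding s_def by (rule tendsto_mult_left_zero)
    qed
    show "\<forall>\<^sub>F x in at_top. AE y in lborel. norm (s x y) \<le> (M + C) * (indicator {..A} y * val b y)"
      using M(2) C(2)
    proof eventually_elim
      case (elim x)
      have "\<bar>val a (x - y) / H x - ratio a x\<bar> \<le> M + C" if "y \<le> A" for y
      proof -
        have "0 \<le> val a (x - y) / H x" "0 \<le> ratio a x"
          by (simp_all add: H_nonneg ratio_nonneg)
        moreover have "val a (x - y) / H x \<le> M"
          using elim that by blast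
        ultimately show ?thesis
          using elim M(1) C(1) by linarith
      qed
      then show ?case
        by (auto simp: s_def abs_mult indicator_def intro!: AE_I2 mult_right_mono)
    qed
  qed simp
  moreover have "\<forall>\<^sub>F x in at_top. (\<integral>y. s x y \<partial>lborel)
     = left_part a b A x / H x - ratio a x * (\<integral>y. indicator {..A} y * val b y \<partial>lborel)"
    using left_integrable(1)[OF a(2,1) b, of A]
  proof eventually_elim
    case (elim x)
    have "s x y = (indicator {..A} y * val a (x - y) * val b y) / H x
        - ratio a x * (indicator {..A} y * val b y)" for y
      by (simp add: s_def algebra_simps)
    then have "(\<integral>y. s x y \<partial>lborel) = (\<integral>y. (indicator {..A} y * val a (x - y) * val b y) / H x
        - ratio a x * (indicator {..A} y * val b y) \<partial>lborel)"
      by simp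
    also have "\<dots> = left_part a b A x / H x - ratio a x * (\<integral>y. indicator {..A} y * val b y \<partial>lborel)"
      using elim int_b by (simp add: left_part_def)
    finally show ?case .
  qed
  ultimately show ?thesis
    by (simp add: tendsto_cong)
qed

lemma mass_left:
  assumes "prob_gdensity b" "\<epsilon> > 0"
  shows "\<forall>\<^sub>F A in at_top.
    \<bar>1 - enn2real (atom b) - (\<integral>y. indicator {..A} y * val b y \<partial>lborel)\<bar> < \<epsilon>"
proof -
  have "((\<lambda>A. \<integral>y. indicator {..A} y *\<^sub>R val b y \<partial>lborel) \<longlongrightarrow> (\<integral>y. val b y \<partial>lborel)) at_top"
    by (rule tendsto_integral_at_top) (simp_all add: val_integral[OF assms(1)])
  from tendstoD[OF this assms(2)] show ?thesis
  proof eventually_elim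
    case (elim A)
    then show ?case
      using val_integral(2)[OF assms(1)] by (simp add: dist_real_def)
  qed
qed

text \<open>
  Convolution adds the ratios to \<open>H\<close> when these are insensitive to shifts: the atom of \<open>b\<close> and the
  part with the argument of \<open>b\<close> below \<open>A\<close> together contribute \<open>ratio a\<close> times almost the whole mass
  of \<open>b\<close>, and symmetrically.
\<close>

lemma ratio_gconv_of_shift_insensitive:
  assumes a: "prob_gdensity a" "bigO a" "shift_insensitive (ratio a)" and b: "prob_gdensity b" "bigO b" "shift_insensitive (ratio b)"
  shows "bigO (gconv a b)"
    and "((\<lambda>x. ratio (gconv a b) x - (ratio a x + ratio b x)) \<longlongrightarrow> 0) at_top"
proof -
  obtain C where C: "C > 0" "\<forall>\<^sub>F x in at_top. ratio a x \<le> C"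
    using bigO_ratio[OF a(2)] by blast
  obtain D where D: "D > 0" "\<forall>\<^sub>F x in at_top. ratio b x \<le> D"
    using bigO_ratio[OF b(2)] by blast
  have main: "\<forall>\<^sub>F x in at_top. ac_part (gconv a b) x < \<top> \<and>
      \<bar>ratio (gconv a b) x - (ratio a x + ratio b x)\<bar> < (4 + C + D) * \<epsilon>" if "\<epsilon> > 0" for \<epsilon> :: real
  proof -
    let ?err = "\<lambda>A x. \<bar>val (gconv a b) x - (enn2real (atom a) * val b x + enn2real (atom b) * val a x
      + left_part a b A x + left_part b a A x)\<bar>"
    have "\<forall>\<^sub>F A in at_top. (\<forall>\<^sub>F x in at_top. ac_part (gconv a b) x < \<top> \<and> ?err A x \<le> \<epsilon> * H x)
      \<and> \<bar>1 - enn2real (atom b) - (\<integral>y. indicator {..A} y * val b y \<partial>lborel)\<bar> < \<epsilon>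
      \<and> \<bar>1 - enn2real (atom a) - (\<integral>y. indicator {..A} y * val a y \<partial>lborel)\<bar> < \<epsilon>"
      by (intro eventually_conj gconv_split mass_left a b that)
    then obtain A where elim: "\<forall>\<^sub>F x in at_top. ac_part (gconv a b) x < \<top> \<and> ?err A x \<le> \<epsilon> * H x"
      "\<bar>1 - enn2real (atom b) - (\<integral>y. indicator {..A} y * val b y \<partial>lborel)\<bar> < \<epsilon>"
      "\<bar>1 - enn2real (atom a) - (\<integral>y. indicator {..A} y * val a y \<partial>lborel)\<bar> < \<epsilon>"
      using eventually_happens'[OF trivial_limit_at_top_linorder] by blast
      define mb where "mb = (\<integral>y. indicator {..A} y * val b y \<partial>lborel)"
      define ma where "ma = (\<integral>y. indicator {..A} y * val a y \<partial>lborel)"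
      have la: "\<forall>\<^sub>F x in at_top. \<bar>left_part a b A x / H x - ratio a x * mb\<bar> < \<epsilon>"
        using tendstoD[OF left_part_shift_insensitive[OF a b(1), of A] that] by (simp add: dist_real_def mb_def)
      have lb: "\<forall>\<^sub>F x in at_top. \<bar>left_part b a A x / H x - ratio b x * ma\<bar> < \<epsilon>"
        using tendstoD[OF left_part_shift_insensitive[OF b a(1), of A] that] by (simp add: dist_real_def ma_def)
      show ?thesis
        using elim(1) la lb C(2) D(2) H_pos
      proof eventually_elim
        case x: (elim x)
        define \<alpha> \<beta> where "\<alpha> = enn2real (atom a)" and "\<beta> = enn2real (atom b)"
        have "\<bar>(val (gconv a b) x - (\<alpha> * val b x + \<beta> * val a x
            + left_part a b A x + left_part b a A x)) / H x\<bar> \<le> \<epsilon>"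
          using x unfolding abs_divide by (simp add: divide_le_eq \<alpha>_def \<beta>_def)
        then have 1: "\<bar>ratio (gconv a b) x - (\<alpha> * ratio b x + \<beta> * ratio a x
            + left_part a b A x / H x + left_part b a A x / H x)\<bar> \<le> \<epsilon>"
          by (simp add: ratio_def diff_divide_distrib add_divide_distrib)
        have "\<bar>ratio a x * (1 - \<beta> - mb)\<bar> \<le> C * \<epsilon>"
          unfolding abs_mult using x elim C(1) ratio_nonneg[of a x]
          by (intro mult_mono) (auto simp: \<beta>_def mb_def)
        moreover have "\<bar>ratio b x * (1 - \<alpha> - ma)\<bar> \<le> D * \<epsilon>"
          unfolding abs_mult using x elim D(1) ratio_nonneg[of b x]
          by (intro mult_mono) (auto simp: \<alpha>_def ma_def)
        ultimately have "\<bar>ratio (gconv a b) x - (ratio a x + ratio b x)\<bar> < (4 + C + D) * \<epsilon>"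
          using 1 x(2,3) that by (simp add: algebra_simps abs_le_iff abs_less_iff)
        then show ?case using x by blast
      qed
  qed
  show lim: "((\<lambda>x. ratio (gconv a b) x - (ratio a x + ratio b x)) \<longlongrightarrow> 0) at_top"
  proof (rule tendstoI)
    fix e :: real assume "e > 0"
    then have "e / (4 + C + D) > 0" using C(1) D(1) by simp
    from main[OF this] show "\<forall>\<^sub>F x in at_top. dist (ratio (gconv a b) x - (ratio a x + ratio b x)) 0 < e"
      using C(1) D(1) by (auto simp: dist_real_def elim!: eventually_mono)
  qed
  show "bigO (gconv a b)"
  proof (rule bigOI_ratio)
    show "\<forall>\<^sub>F x in at_top. ac_part (gconv a b) x < \<top>"
      using main[of 1] by (auto elim!: eventually_mono)
    show "\<forall>\<^sub>F x in at_top. ratio (gconv a b) x \<le> C + D + (4 + C + D) * 1"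
      using main[OF zero_less_one] C(2) D(2)
    proof eventually_elim
      case (elim x)
      then show ?case by (simp add: abs_less_iff)
    qed
  qed
qed

text \<open>
  If \<open>ratio a\<close> is asymptotically decreasing, then so is the left part normalized by \<open>H\<close>, and a drop of \<open>ratio a\<close> over a distance \<open>c\<close> forces a proportional drop of the left part. For
  \<open>-B \<le> y \<le> B\<close> the interval from \<open>x + B\<close> to \<open>x + B + c\<close> lies between \<open>x - y\<close> and
  \<open>x + (c + 2 * B) - y\<close>, whence the shift by \<open>c + 2 * B\<close>.
\<close>

lemma left_part_drop:
  assumes a: "prob_gdensity a" "bigO a" "asymp_decreasing (ratio a)" and b: "prob_gdensity b"
    and "0 \<le> B" "B \<le> A" "0 < c" "0 < \<epsilon>"
  shows "\<forall>\<^sub>F x in at_top. left_part a b A x / H x - left_part a b A (x + (c + 2 * B)) / H (x + (c + 2 * B))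
    \<ge> max 0 (ratio a (x + B) - ratio a (x + B + c)) * (\<integral>y. indicator {-B..B} y * val b y \<partial>lborel) - \<epsilon>"
proof -
  note [measurable] = val_measurable[OF a(1)] val_measurable[OF b]
  have int_b: "integrable lborel (\<lambda>y. indicator S y * val b y)" if "S \<in> sets borel" for S
    using integrable_mult_indicator[OF _ val_integral(1)[OF b], of S] that by simp
  define d where "d = c + 2 * B"
  define \<delta> where "\<delta> x = max 0 (ratio a (x + B) - ratio a (x + B + c))" for x
  define \<phi> where "\<phi> x y = val a (x - y) / H x - val a (x + d - y) / H (x + d)" for x y
  obtain M where M: "M > 0" "\<forall>\<^sub>F x in at_top. \<forall>y\<le>A. val a (x - y) / H x \<le> M"
    using left_bound_val[OF a(2)] by blast
  obtain C where C: "C > 0" "\<forall>\<^sub>F x in at_top. ratio a x \<le> C"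
    using bigO_ratio[OF a(2)] by blast
  \<comment> \<open>The integrand \<open>\<phi>\<close> falls short of its asymptotic lower bound at most by \<open>s\<close>, whose integral tends to \<open>0\<close>.\<close>
  define s where "s x y = max 0 (indicator {-B..B} y * \<delta> x - \<phi> x y) * (indicator {..A} y * val b y)" for x y
  have low: "\<forall>\<^sub>F x in at_top. indicator {-B..B} y * \<delta> x - \<phi> x y \<le> \<eta>" if "\<eta> > 0" for y \<eta>
  proof -
    define e where "e = \<eta> / 4"
    have "e > 0" and \<eta>: "\<eta> = 4 * e" using that by (simp_all add: e_def)
    have v1: "\<forall>\<^sub>F x in at_top. \<bar>val a (x - y) / H x - ratio a (x - y)\<bar> < e"
      using tendstoD[OF val_shift[OF a(2), of y] \<open>e > 0\<close>] by (simp add: dist_real_def)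
    have v2: "\<forall>\<^sub>F x in at_top. \<bar>val a (x + d - y) / H (x + d) - ratio a (x + d - y)\<bar> < e"
      by (rule eventually_compose_filterlim[OF v1 filterlim_shift'])
    have dec: "\<forall>\<^sub>F x in at_top. ratio a (x + t) \<le> ratio a (x + s) + e" if "s \<le> t" for s t
    proof -
      have "\<forall>\<^sub>F x in at_top. ratio a (x + (t - s)) \<le> ratio a x + e"
        using a(3) that \<open>e > 0\<close> by (simp add: asymp_decreasing_def)
      from eventually_compose_filterlim[OF this filterlim_shift'[of s]]
      show ?thesis by (simp add: algebra_simps)
    qed
    show ?thesis
    proof (cases "y \<in> {-B..B}")
      case False
      have "\<forall>\<^sub>F x in at_top. ratio a (x + (d - y)) \<le> ratio a (x + (-y)) + e"
        using assms by (intro dec) (auto simp: d_def)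
      with v1 v2 show ?thesis
      proof eventually_elim
        case (elim x)
        then show ?case
          using False \<open>e > 0\<close> by (simp add: \<phi>_def \<eta> algebra_simps abs_less_iff)
      qed
    next
      case True
      have "\<forall>\<^sub>F x in at_top. ratio a (x + B) \<le> ratio a (x + (-y)) + e"
        "\<forall>\<^sub>F x in at_top. ratio a (x + (d - y)) \<le> ratio a (x + (B + c)) + e"
        "\<forall>\<^sub>F x in at_top. ratio a (x + (d - y)) \<le> ratio a (x + (-y)) + e"
        using assms True by (intro dec; auto simp: d_def)+
      with v1 v2 show ?thesis
      proof eventually_elim
        case (elim x)
        then show ?case
          using True \<open>e > 0\<close> by (auto simp: max_def \<phi>_def \<delta>_def \<eta> algebra_simps abs_less_iff)
      qed
    qed
  qed
  have "((\<lambda>x. \<integral>y. s x y \<partial>lborel) \<longlongrightarrow> integral\<^sup>L lborel (\<lambda>y::real. 0)) at_top"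
  proof (rule integral_dominated_convergence_at_top)
    show "integrable lborel (\<lambda>y. (C + M) * (indicator {..A} y * val b y))"
      by (intro integrable_mult_right int_b) simp
    show "s x \<in> borel_measurable lborel" for x
      unfolding s_def \<phi>_def by measurable
    show "AE y in lborel. ((\<lambda>x. s x y) \<longlongrightarrow> 0) at_top"
    proof (rule AE_I2)
      fix y
      have "((\<lambda>x. max 0 (indicator {-B..B} y * \<delta> x - \<phi> x y)) \<longlongrightarrow> 0) at_top"
      proof (rule tendstoI)
        fix e :: real assume "e > 0"
        then have "e / 2 > 0" by simp
        from low[OF this, of y] show "\<forall>\<^sub>F x in at_top. dist (max 0 (indicator {-B..B} y * \<delta> x - \<phi> x y)) 0 < e"
        proof eventually_elim
          case (elim x)
          then show ?case using \<open>e > 0\<close> by (simp add: dist_real_def)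
        qed
      qed
      then show "((\<lambda>x. s x y) \<longlongrightarrow> 0) at_top"
        unfolding s_def by (rule tendsto_mult_left_zero)
    qed
    show "\<forall>\<^sub>F x in at_top. AE y in lborel. norm (s x y) \<le> (C + M) * (indicator {..A} y * val b y)"
      using eventually_compose_filterlim[OF M(2) filterlim_shift'[of d]]
        eventually_compose_filterlim[OF C(2) filterlim_shift'[of B]]
    proof eventually_elim
      case (elim x)
      have le: "max 0 (indicator {-B..B} y * \<delta> x - \<phi> x y) \<le> C + M" if "y \<le> A" for y
      proof -
        have "0 \<le> val a (x - y) / H x" "0 \<le> ratio a (x + B + c)"
          by (simp_all add: H_nonneg ratio_nonneg)
        moreover have "val a (x + d - y) / H (x + d) \<le> M"
          using elim that by blast
        moreover have "indicator {-B..B} y * \<delta> x \<le> \<delta> x"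
          by (simp add: indicator_def \<delta>_def)
        ultimately show ?thesis
          using elim M(1) C(1) unfolding \<phi>_def \<delta>_def by linarith
      qed
      show ?case
      proof (rule AE_I2)
        fix y
        have "norm (s x y) = max 0 (indicator {-B..B} y * \<delta> x - \<phi> x y) * (indicator {..A} y * val b y)"
          by (simp add: s_def abs_mult)
        also have "\<dots> \<le> (C + M) * (indicator {..A} y * val b y)"
          using le[of y] by (cases "y \<le> A") (simp_all add: mult_right_mono del: max.bounded_iff)
        finally show "norm (s x y) \<le> (C + M) * (indicator {..A} y * val b y)" .
      qed
    qed
  qed simp
  then have "((\<lambda>x. \<integral>y. s x y \<partial>lborel) \<longlongrightarrow> 0) at_top" by simp
  from order_tendstoD(2)[OF this \<open>\<epsilon> > 0\<close>] left_integrable(1)[OF a(2,1) b, of A]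
    eventually_compose_filterlim[OF left_integrable(1)[OF a(2,1) b, of A] filterlim_shift'[of d]]
    eventually_compose_filterlim[OF M(2) filterlim_shift'[of d]]
    eventually_compose_filterlim[OF C(2) filterlim_shift'[of B]]
  show ?thesis
    unfolding d_def[symmetric] \<delta>_def[symmetric]
  proof eventually_elim
    case (elim x)
    let ?l = "\<lambda>y. \<delta> x * (indicator {-B..B} y * val b y)"
    let ?r = "\<lambda>y. (indicator {..A} y * val a (x - y) * val b y) / H x
        - (indicator {..A} y * val a (x + d - y) * val b y) / H (x + d)"
    have int_r: "integrable lborel ?r"
      using elim by simp
    have int_l: "integrable lborel ?l"
      using int_b by simp
    have eq: "?l y - ?r y = (indicator {-B..B} y * \<delta> x - \<phi> x y) * (indicator {..A} y * val b y)" for y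
      using \<open>B \<le> A\<close> by (auto simp: \<phi>_def indicator_def algebra_simps)
    have le: "?l y - ?r y \<le> s x y" for y
      unfolding s_def eq by (intro mult_right_mono) simp_all
    have int_s: "integrable lborel (s x)"
    proof -
      have "s x = (\<lambda>y. max 0 (?l y - ?r y))"
        unfolding s_def eq by (simp add: fun_eq_iff max_mult_distrib_right)
      moreover have "integrable lborel (\<lambda>y. max 0 (?l y - ?r y))"
        using int_l int_r by (intro integrable_max) simp_all
      ultimately show ?thesis by simp
    qed
    have "(\<integral>y. ?l y - ?r y \<partial>lborel) \<le> (\<integral>y. s x y \<partial>lborel)"
      using int_l int_r int_s le by (intro integral_mono) auto
    then have "\<delta> x * (\<integral>y. indicator {-B..B} y * val b y \<partial>lborel)
        - (left_part a b A x / H x - left_part a b A (x + d) / H (x + d)) \<le> (\<integral>y. s x y \<partial>lborel)"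
      using int_l int_r elim by (simp add: left_part_def)
    then show ?case
      using elim by simp
  qed
qed

text \<open>
  A sum of asymptotically decreasing functions can only converge if none of them drops. Applied to the
  terms of \<open>gconv_split\<close>, this turns monotonicity of \<open>ratio a\<close> and \<open>ratio b\<close> into insensitivity to
  shifts.
\<close>

lemma shift_insensitive_of_asymp_decreasing:
  assumes a: "prob_gdensity a" "bigO a" "asymp_decreasing (ratio a)" and b: "prob_gdensity b" "bigO b" "asymp_decreasing (ratio b)"
    and lim: "(ratio (gconv a b) \<longlongrightarrow> L) at_top"
    and pos: "0 < (\<integral>y. val b y \<partial>lborel)"
  shows "shift_insensitive (ratio a)"
proof (rule shift_insensitiveI)
  fix c :: real assume "c > 0"
  note [measurable] = val_measurable[OF b(1)]
  have "((\<lambda>B. \<integral>y. indicator {-B..B} y * val b y \<partial>lborel) \<longlongrightarrow> (\<integral>y. val b y \<partial>lborel)) at_top"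
  proof (rule integral_dominated_convergence_at_top)
    show "integrable lborel (val b)"
      by (rule val_integral(1)[OF b(1)])
    show "AE y in lborel. ((\<lambda>B. indicator {-B..B} y * val b y) \<longlongrightarrow> val b y) at_top"
    proof (rule AE_I2)
      fix y :: real
      have "\<forall>\<^sub>F B in at_top. indicator {-B..B} y * val b y = val b y"
        using eventually_ge_at_top[of "\<bar>y\<bar>"] by eventually_elim (auto simp: indicator_def)
      then show "((\<lambda>B. indicator {-B..B} y * val b y) \<longlongrightarrow> val b y) at_top"
        by (rule tendsto_eventually)
    qed
    show "\<forall>\<^sub>F B in at_top. AE y in lborel. norm (indicator {-B..B} y * val b y) \<le> val b y"
      by (auto simp: indicator_def)
  qed simp_all
  from eventually_conj[OF order_tendstoD(1)[OF this pos] eventually_ge_at_top[of 0]]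
  obtain B :: real where B: "0 \<le> B" and m: "0 < (\<integral>y. indicator {-B..B} y * val b y \<partial>lborel)"
    using eventually_happens'[OF trivial_limit_at_top_linorder] by blast
  define m where "m = (\<integral>y. indicator {-B..B} y * val b y \<partial>lborel)"
  have m_pos: "0 < m" using m by (simp add: m_def)
  define d where "d = c + 2 * B"
  have "d \<ge> 0" using B \<open>c > 0\<close> by (simp add: d_def)
  have upper: "\<forall>\<^sub>F x in at_top. ratio a x - ratio a (x + c) \<le> 8 * \<epsilon> / m" if "\<epsilon> > 0" for \<epsilon>
  proof -
    define \<alpha> \<beta> where "\<alpha> = enn2real (atom a)" and "\<beta> = enn2real (atom b)"
    have nonneg: "0 \<le> (\<integral>y. val g y \<partial>lborel)" for g
      by simp
    have "enn2real (atom g) \<le> 1" if "prob_gdensity g" for g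
      using val_integral(2)[OF that] nonneg[of g] by linarith
    then have \<alpha>\<beta>: "0 \<le> \<alpha>" "\<alpha> \<le> 1" "0 \<le> \<beta>" "\<beta> \<le> 1"
      using a(1) b(1) by (simp_all add: \<alpha>_def \<beta>_def)
    have "\<forall>\<^sub>F A in at_top. B \<le> A \<and> (\<forall>\<^sub>F x in at_top. ac_part (gconv a b) x < \<top> \<and>
      \<bar>val (gconv a b) x - (\<alpha> * val b x + \<beta> * val a x
        + left_part a b A x + left_part b a A x)\<bar> \<le> \<epsilon> * H x)"
      unfolding \<alpha>_def \<beta>_def
      by (intro eventually_conj gconv_split a b that eventually_ge_at_top)
    then obtain A where A: "B \<le> A" "\<forall>\<^sub>F x in at_top. ac_part (gconv a b) x < \<top> \<and>
      \<bar>val (gconv a b) x - (\<alpha> * val b x + \<beta> * val a x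
        + left_part a b A x + left_part b a A x)\<bar> \<le> \<epsilon> * H x"
      using eventually_happens'[OF trivial_limit_at_top_linorder] by blast
    define R where "R x = \<alpha> * ratio b x + \<beta> * ratio a x
        + left_part a b A x / H x + left_part b a A x / H x" for x
    have "\<forall>\<^sub>F x in at_top. \<bar>ratio (gconv a b) x - L\<bar> < \<epsilon>"
      using tendstoD[OF lim that] by (simp add: dist_real_def)
    then have R: "\<forall>\<^sub>F x in at_top. \<bar>R x - L\<bar> < 2 * \<epsilon>"
      using A(2) H_pos
    proof eventually_elim
      case (elim x)
      have "\<bar>(val (gconv a b) x - (\<alpha> * val b x + \<beta> * val a x
          + left_part a b A x + left_part b a A x)) / H x\<bar> \<le> \<epsilon>"
        using elim unfolding abs_divide by (simp add: divide_le_eq)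
      then have "\<bar>ratio (gconv a b) x - R x\<bar> \<le> \<epsilon>"
        by (simp add: R_def ratio_def diff_divide_distrib add_divide_distrib)
      then show ?case
        using elim(1) by linarith
    qed
    have R': "\<forall>\<^sub>F x in at_top. \<bar>R (x + d) - L\<bar> < 2 * \<epsilon>"
      by (rule eventually_compose_filterlim[OF R filterlim_shift'])
    have dec_a: "\<forall>\<^sub>F x in at_top. ratio a (x + d) \<le> ratio a x + \<epsilon>"
      and dec_b: "\<forall>\<^sub>F x in at_top. ratio b (x + d) \<le> ratio b x + \<epsilon>"
      using a(3) b(3) that \<open>d \<ge> 0\<close> by (auto simp: asymp_decreasing_def)
    have "\<forall>\<^sub>F x in at_top. ratio a (x + B) - ratio a (x + B + c) \<le> 8 * \<epsilon> / m"
      using R R' dec_a dec_b left_part_drop[OF a b(1) B A(1) \<open>c > 0\<close> that]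
        left_part_drop[OF b a(1) B A(1) \<open>c > 0\<close> that]
      unfolding d_def[symmetric] m_def[symmetric]
    proof eventually_elim
      case (elim x)
      have scale: "\<gamma> * t \<le> \<epsilon>" if "0 \<le> \<gamma>" "\<gamma> \<le> 1" "t \<le> \<epsilon>" for \<gamma> t
        using mult_left_mono[OF that(3,1)] mult_right_mono[OF that(2), of \<epsilon>] \<open>\<epsilon> > 0\<close> by linarith
      have 1: "\<alpha> * (ratio b (x + d) - ratio b x) \<le> \<epsilon>"
        and 2: "\<beta> * (ratio a (x + d) - ratio a x) \<le> \<epsilon>"
        using elim \<alpha>\<beta> by (intro scale; linarith)+
      have 3: "0 \<le> max 0 (ratio b (x + B) - ratio b (x + B + c)) *
          (\<integral>y. indicator {-B..B} y * val a y \<partial>lborel)"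
        by (intro mult_nonneg_nonneg Bochner_Integration.integral_nonneg) auto
      \<comment> \<open>\<open>R\<close> changes by at most \<open>4 * \<epsilon>\<close>, and each of its four terms increases by at most \<open>\<epsilon>\<close>.\<close>
      have "max 0 (ratio a (x + B) - ratio a (x + B + c)) * m \<le> 8 * \<epsilon>"
      proof -
        have "R x - R (x + d) \<le> 4 * \<epsilon>"
          using elim(1,2) by linarith
        then show ?thesis
          using elim(5,6) 1 2 3 unfolding R_def right_diff_distrib by linarith
      qed
      moreover have "(ratio a (x + B) - ratio a (x + B + c)) * m
          \<le> max 0 (ratio a (x + B) - ratio a (x + B + c)) * m"
        using m_pos by (intro mult_right_mono) auto
      ultimately show ?case
        unfolding pos_le_divide_eq[OF m_pos] by linarith
    qed
    from eventually_compose_filterlim[OF this filterlim_shift[of B]]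
    show ?thesis by simp
  qed
  show "((\<lambda>x. ratio a x - ratio a (x + c)) \<longlongrightarrow> 0) at_top"
  proof (rule tendstoI)
    fix e :: real assume "e > 0"
    then have "e / 2 > 0" "e * m / 16 > 0" using m_pos by simp_all
    have "\<forall>\<^sub>F x in at_top. ratio a (x + c) \<le> ratio a x + e / 2"
      using a(3) \<open>c > 0\<close> \<open>e / 2 > 0\<close> by (auto simp: asymp_decreasing_def)
    with upper[OF \<open>e * m / 16 > 0\<close>]
    show "\<forall>\<^sub>F x in at_top. dist (ratio a x - ratio a (x + c)) 0 < e"
    proof eventually_elim
      case (elim x)
      have "8 * (e * m / 16) / m = e / 2" using m by (simp add: m_def)
      then show ?case
        using elim \<open>e > 0\<close> by (simp add: dist_real_def abs_less_iff)
    qed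
  qed
qed

end

section \<open>Lower bounds for convolutions\<close>

text \<open>
  A version of Fatou's lemma for the limit \<open>x \<rightarrow> \<infinity>\<close>; truncating the quotient \<open>v (x - y) / v x\<close> at
  \<open>\<kappa>\<close> makes dominated convergence applicable.
\<close>

lemma nn_conv_lower:
  fixes v b :: "real \<Rightarrow> real"
  assumes [measurable]: "v \<in> borel_measurable borel" "S \<in> sets borel"
    and v: "\<And>x. 0 \<le> v x" and b: "\<And>x. 0 \<le> b x" and int_b: "integrable lborel b"
    and pos: "\<forall>\<^sub>F x in at_top. 0 < v x" and "0 < \<kappa>" "0 < \<eta>"
    and shift: "\<And>y. y \<in> S \<Longrightarrow> \<forall>\<^sub>F x in at_top. \<kappa> * v x \<le> v (x - y)"
  shows "\<forall>\<^sub>F x in at_top. ennreal ((\<kappa> * (\<integral>y. indicator S y * b y \<partial>lborel) - \<eta>) * v x)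
    \<le> (\<integral>\<^sup>+y. indicator S y * ennreal (v (x - y) * b y) \<partial>lborel)"
proof -
  have [measurable]: "b \<in> borel_measurable borel"
    using borel_measurable_integrable[OF int_b] by simp
  have int_Sb: "integrable lborel (\<lambda>y. indicator S y * b y)"
    using integrable_mult_indicator[OF _ int_b, of S] by simp
  define s where "s x y = min \<kappa> (v (x - y) / v x) * (indicator S y * b y)" for x y
  have bound: "norm (s x y) \<le> \<kappa> * (indicator S y * b y)" for x y
    using v[of x] v[of "x - y"] b[of y] \<open>0 < \<kappa>\<close>
    by (auto simp: s_def abs_mult indicator_def intro!: mult_right_mono)
  have s0: "0 \<le> s x y" for x y
    using v[of x] v[of "x - y"] b[of y] \<open>0 < \<kappa>\<close> by (simp add: s_def)
  have int_s: "integrable lborel (s x)" for x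
  proof (rule Bochner_Integration.integrable_bound)
    show "integrable lborel (\<lambda>y. \<kappa> * (indicator S y * b y))"
      using int_Sb by simp
    show "AE y in lborel. norm (s x y) \<le> norm (\<kappa> * (indicator S y * b y))"
      using bound \<open>0 < \<kappa>\<close> b by (auto simp: abs_mult)
  qed (simp add: s_def[abs_def])
  have "((\<lambda>x. \<integral>y. s x y \<partial>lborel) \<longlongrightarrow> (\<integral>y. \<kappa> * (indicator S y * b y) \<partial>lborel)) at_top"
  proof (rule integral_dominated_convergence_at_top)
    show "integrable lborel (\<lambda>y. \<kappa> * (indicator S y * b y))"
      using int_Sb by simp
    show "\<forall>\<^sub>F x in at_top. AE y in lborel. norm (s x y) \<le> \<kappa> * (indicator S y * b y)"
      using bound by simp
    show "AE y in lborel. ((\<lambda>x. s x y) \<longlongrightarrow> \<kappa> * (indicator S y * b y)) at_top"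
    proof (rule AE_I2)
      fix y
      have "\<forall>\<^sub>F x in at_top. s x y = \<kappa> * (indicator S y * b y)"
      proof (cases "y \<in> S")
        case True
        from shift[OF this] pos show ?thesis
          by eventually_elim (simp add: s_def min_def pos_divide_less_eq field_simps)
      qed (simp add: s_def)
      then show "((\<lambda>x. s x y) \<longlongrightarrow> \<kappa> * (indicator S y * b y)) at_top"
        by (rule tendsto_eventually)
    qed
  qed (simp_all add: s_def[abs_def])
  then have "((\<lambda>x. \<integral>y. s x y \<partial>lborel) \<longlongrightarrow> \<kappa> * (\<integral>y. indicator S y * b y \<partial>lborel)) at_top"
    by simp
  then have "\<forall>\<^sub>F x in at_top. \<kappa> * (\<integral>y. indicator S y * b y \<partial>lborel) - \<eta> < (\<integral>y. s x y \<partial>lborel)"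
    by (rule order_tendstoD) (use \<open>0 < \<eta>\<close> in simp)
  then show ?thesis
    using pos
  proof eventually_elim
    case (elim x)
    have "ennreal ((\<kappa> * (\<integral>y. indicator S y * b y \<partial>lborel) - \<eta>) * v x)
        \<le> ennreal ((\<integral>y. s x y \<partial>lborel) * v x)"
      using elim by (intro ennreal_leI mult_right_mono) auto
    also have "\<dots> = (\<integral>\<^sup>+y. ennreal (s x y * v x) \<partial>lborel)"
      using int_s[of x] s0 v by (subst nn_integral_eq_integral) auto
    also have "\<dots> \<le> (\<integral>\<^sup>+y. indicator S y * ennreal (v (x - y) * b y) \<partial>lborel)"
    proof (rule nn_integral_mono)
      fix y
      have "s x y * v x \<le> v (x - y) / v x * (indicator S y * b y) * v x"
        unfolding s_def using b[of y] v[of x] by (intro mult_right_mono) auto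
      also have "\<dots> = indicator S y * (v (x - y) * b y)"
        using elim by simp
      finally have "ennreal (s x y * v x) \<le> ennreal (indicator S y * (v (x - y) * b y))"
        by (rule ennreal_leI)
      then show "ennreal (s x y * v x) \<le> indicator S y * ennreal (v (x - y) * b y)"
        by (cases "y \<in> S") simp_all
    qed
    finally show ?case .
  qed
qed

text \<open>
  A convolution factor is dominated by the convolution, provided that the other factor has an atom or
  charges a set of shifts \<open>y\<close> for which \<open>a (x - y)\<close> is eventually at least half of \<open>a x\<close>.
\<close>

lemma (in subexp_tail) bigO_of_factor:
  assumes a: "prob_gdensity a" and b: "prob_gdensity b" and [measurable]: "S \<in> sets borel"
    and pos: "\<forall>\<^sub>F x in at_top. 0 < ac_part a x \<and> ac_part a x < \<top>"
    and shift: "\<And>y. y \<in> S \<Longrightarrow> \<forall>\<^sub>F x in at_top. val a x \<le> 2 * val a (x - y)"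
    and mass: "0 < enn2real (atom b) + (\<integral>y. indicator S y * val b y \<partial>lborel)"
    and H: "\<forall>\<^sub>F x in at_top. ac_part (gconv a b) x = ennreal (H x)"
  shows "bigO a"
proof -
  note [measurable] = prob_gdensity_measurable[OF a] prob_gdensity_measurable[OF b]
  define \<beta> m where "\<beta> = enn2real (atom b)" and "m = (\<integral>y. indicator S y * val b y \<partial>lborel)"
  have "0 \<le> \<beta>" by (simp add: \<beta>_def)
  \<comment> \<open>Then \<open>\<beta> + (m / 2 - \<eta>) \<ge> \<eta>\<close>.\<close>
  define \<eta> where "\<eta> = (\<beta> + m) / 4"
  have "0 < \<eta>" using mass by (simp add: \<eta>_def \<beta>_def m_def)
  have "\<forall>\<^sub>F x in at_top. ennreal ((1 / 2 * m - \<eta>) * val a x)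
    \<le> (\<integral>\<^sup>+y. indicator S y * ennreal (val a (x - y) * val b y) \<partial>lborel)"
    unfolding m_def
  proof (rule nn_conv_lower)
    show "\<forall>\<^sub>F x in at_top. 0 < val a x"
      using pos by eventually_elim (simp add: val_def enn2real_positive_iff)
    show "\<forall>\<^sub>F x in at_top. 1 / 2 * val a x \<le> val a (x - y)" if "y \<in> S" for y
      using shift[OF that] by eventually_elim simp
  qed (use val_measurable[OF a] val_integral(1)[OF b] \<open>0 < \<eta>\<close> in simp_all)
  then have "\<forall>\<^sub>F x in at_top. ac_part a x \<le> ennreal (1 / \<eta> * H x)"
    using H pos
  proof eventually_elim
    case (elim x)
    have le: "ennreal (val g z) \<le> ac_part g z" for g z
      by (cases "ac_part g z") (simp_all add: val_def)
    have "ennreal (\<eta> * val a x) \<le> ennreal (\<beta> * val a x + (1 / 2 * m - \<eta>) * val a x)"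
      using \<open>0 \<le> \<beta>\<close> by (intro ennreal_leI) (simp add: \<eta>_def field_simps)
    also have "\<dots> \<le> ennreal (\<beta> * val a x) + ennreal ((1 / 2 * m - \<eta>) * val a x)"
    proof (cases "0 \<le> (1 / 2 * m - \<eta>) * val a x")
      case False
      then have "ennreal (\<beta> * val a x + (1 / 2 * m - \<eta>) * val a x) \<le> ennreal (\<beta> * val a x)"
        by (intro ennreal_leI) linarith
      then show ?thesis
        by (rule order_trans) (simp only: le_iff_add, blast)
    qed (use \<open>0 \<le> \<beta>\<close> in simp)
    also have "\<dots> \<le> atom b * ac_part a x
        + (\<integral>\<^sup>+y. indicator S y * ennreal (val a (x - y) * val b y) \<partial>lborel)"
    proof (intro add_mono elim(1))
      show "ennreal (\<beta> * val a x) \<le> atom b * ac_part a x"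
        using le[of a x] val_integral(3)[OF b]
        by (simp add: \<beta>_def ennreal_mult mult_left_mono)
    qed
    also have "(\<integral>\<^sup>+y. indicator S y * ennreal (val a (x - y) * val b y) \<partial>lborel)
        \<le> (\<integral>\<^sup>+y. ac_part a (x - y) * ac_part b y \<partial>lborel)"
      by (intro nn_integral_mono)
        (auto simp: indicator_def ennreal_mult intro!: mult_mono le)
    also have "atom b * ac_part a x + (\<integral>\<^sup>+y. ac_part a (x - y) * ac_part b y \<partial>lborel)
        \<le> ac_part (gconv a b) x"
      by (simp add: gconv_def add_increasing)
    also have "\<dots> = ennreal (H x)" by (rule elim)
    finally have "\<eta> * val a x \<le> H x"
      using H_nonneg by (simp add: ennreal_le_iff)
    then have "ennreal (val a x) \<le> ennreal (1 / \<eta> * H x)"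
      using \<open>0 < \<eta>\<close> by (intro ennreal_leI) (simp add: field_simps)
    then show ?case
      using elim by (simp add: ennreal_val)
  qed
  then show ?thesis
    unfolding bigO_def using \<open>0 < \<eta>\<close> by (intro exI[of _ "1 / \<eta>"]) simp
qed

section \<open>Consequences of the tail conditions\<close>

lemma shift_ratio_tendsto:
  fixes v :: "real \<Rightarrow> real"
  assumes "\<And>y. y > 0 \<Longrightarrow> ((\<lambda>x. v (x + y) / v x) \<longlongrightarrow> 1) at_top"
    and pos: "\<forall>\<^sub>F x in at_top. 0 < v x"
  shows "((\<lambda>x. v (x - y) / v x) \<longlongrightarrow> 1) at_top"
proof -
  consider "y = 0" | "y > 0" | "y < 0" by linarith
  then show ?thesis
  proof cases
    case 1
    have "\<forall>\<^sub>F x in at_top. v (x - y) / v x = 1"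
      using pos by eventually_elim (simp add: 1)
    then show ?thesis by (rule tendsto_eventually)
  next
    case 2
    have "((\<lambda>x. v x / v (x - y)) \<longlongrightarrow> 1) at_top"
      using filterlim_compose[OF assms(1)[OF 2] filterlim_shift[of y]] by simp
    from tendsto_inverse[OF this] show ?thesis by simp
  next
    case 3
    then show ?thesis using assms(1)[of "-y"] by simp
  qed
qed

lemma long_tailed_val:
  assumes "long_tailed g"
  shows "\<forall>\<^sub>F x in at_top. 0 < ac_part g x \<and> ac_part g x < \<top>"
    and "((\<lambda>x. val g (x - y) / val g x) \<longlongrightarrow> 1) at_top"
proof -
  have eq: "tail_equiv (\<lambda>x. ac_part g (x + y)) (ac_part g)" if "y > 0" for y
    using assms that by (simp add: long_tailed_def)
  show fin: "\<forall>\<^sub>F x in at_top. 0 < ac_part g x \<and> ac_part g x < \<top>"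
    using eq[of 1] unfolding tail_equiv_val by (auto elim: eventually_mono)
  show "((\<lambda>x. val g (x - y) / val g x) \<longlongrightarrow> 1) at_top"
  proof (rule shift_ratio_tendsto)
    show "((\<lambda>x. val g (x + y) / val g x) \<longlongrightarrow> 1) at_top" if "y > 0" for y
      using eq[OF that] unfolding tail_equiv_val val_def by blast
    show "\<forall>\<^sub>F x in at_top. 0 < val g x"
      using fin by eventually_elim (simp add: val_def enn2real_positive_iff)
  qed
qed

lemma ani_sup:
  assumes "ani g" and "1 < c"
  shows "\<forall>\<^sub>F x in at_top. \<forall>t\<ge>x. val g t \<le> c * val g x"
proof -
  have eq: "tail_equiv (\<lambda>x. SUP t\<in>{x..}. ac_part g t) (ac_part g)"
    using assms by (auto simp: ani_def)
  let ?s = "\<lambda>x. SUP t\<in>{x..}. ac_part g t"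
  have "\<forall>\<^sub>F x in at_top. enn2real (?s x) / val g x < c"
    using eq assms(2) unfolding tail_equiv_val val_def by (auto intro: order_tendstoD)
  moreover have "\<forall>\<^sub>F x in at_top. 0 < ?s x \<and> ?s x < \<top> \<and> 0 < ac_part g x \<and> ac_part g x < \<top>"
    using eq unfolding tail_equiv_val by blast
  ultimately show ?thesis
  proof eventually_elim
    case (elim x)
    show ?case
    proof (intro allI impI)
      fix t assume "x \<le> t"
      then have "ac_part g t \<le> ?s x"
        by (intro SUP_upper) simp
      then have "val g t \<le> enn2real (?s x)"
        unfolding val_def using elim by (intro enn2real_mono) simp_all
      also have "\<dots> \<le> c * val g x"
      proof -
        have "0 < val g x"
          using elim by (simp add: val_def enn2real_positive_iff)
        then show ?thesis
          using elim(1) by (simp only: pos_divide_less_eq less_imp_le)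
      qed
      finally show "val g t \<le> c * val g x" .
    qed
  qed
qed

lemma ani_finite:
  assumes "ani g"
  shows "\<forall>\<^sub>F x in at_top. 0 < ac_part g x \<and> ac_part g x < \<top>"
  using assms unfolding ani_def tail_equiv_val by (auto elim: eventually_mono)

lemma integral_pos_of_eventually_pos:
  fixes v :: "real \<Rightarrow> real"
  assumes int: "integrable lborel v" and v: "\<And>x. 0 \<le> v x" and pos: "\<forall>\<^sub>F x in at_top. 0 < v x"
  shows "0 < (\<integral>x. indicator {0..} x * v x \<partial>lborel)"
proof -
  have int': "integrable lborel (\<lambda>x. indicator {0..} x * v x)"
    using integrable_mult_indicator[OF _ int, of "{0..}"] by simp
  from pos obtain X where X: "\<And>x. x \<ge> X \<Longrightarrow> 0 < v x"
    by (auto simp: eventually_at_top_linorder)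
  have nn: "0 \<le> (\<integral>x. indicator {0..} x * v x \<partial>lborel)"
    using v by (intro Bochner_Integration.integral_nonneg) simp
  moreover have "(\<integral>x. indicator {0..} x * v x \<partial>lborel) \<noteq> 0"
  proof
    assume "(\<integral>x. indicator {0..} x * v x \<partial>lborel) = 0"
    then have "AE x in lborel. indicator {0..} x * v x = 0"
      using integral_nonneg_eq_0_iff_AE[OF int'] v by simp
    then have "AE x in lborel. x \<notin> {max 0 X..max 0 X + 1}"
    proof eventually_elim
      case (elim x)
      then show ?case using X[of x] by (auto simp: indicator_def split: if_splits)
    qed
    then have "{max 0 X..max 0 X + 1} \<in> null_sets lborel"
      using AE_iff_null_sets[of "{max 0 X..max 0 X + 1}" lborel] by simp
    then show False
      by (simp add: null_sets_def)
  qed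
  ultimately show ?thesis by linarith
qed

text \<open>
  A weakly subexponential a.n.i. density can serve as reference function. Write \<open>H\<close> for its values
  and \<open>I\<close> for its mass on the positive half-line. Subexponentiality of the normalized restriction says
  that the integral of \<open>H (x - y) * H y\<close> over \<open>0 \<le> y \<le> x\<close> is asymptotic to \<open>2 * I * H x\<close>. Each of the ranges
  \<open>0 \<le> y \<le> A\<close> and \<open>x - A \<le> y \<le> x\<close> contributes asymptotically at least \<open>H x\<close> times the mass of
  \<open>{0..A}\<close>, which is close to \<open>I\<close>; hence little is left for the middle.
\<close>

lemma subexp_tail_val:
  assumes g: "prob_gdensity g" and w: "weakly_subexponential g" and ani: "ani g"
  shows "subexp_tail (val g)"
proof -
  note [measurable] = prob_gdensity_measurable[OF g] val_measurable[OF g]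
  define w where "w = ac_weight g"
  define wr where "wr = (\<integral>x. val g x \<partial>lborel)"
  define I where "I = (\<integral>x. indicator {0..} x * val g x \<partial>lborel)"
  have fin: "\<forall>\<^sub>F x in at_top. 0 < ac_part g x \<and> ac_part g x < \<top>"
    by (rule ani_finite[OF ani])
  then have pos: "\<forall>\<^sub>F x in at_top. 0 < val g x"
    by eventually_elim (simp add: val_def enn2real_positive_iff)
  have int: "integrable lborel (val g)"
    by (rule val_integral(1)[OF g])
  have int_S: "integrable lborel (\<lambda>x. indicator S x * val g x)" if "S \<in> sets borel" for S
    using integrable_mult_indicator[OF _ int, of S] that by simp
  have I_pos: "0 < I"
    unfolding I_def by (rule integral_pos_of_eventually_pos[OF int _ pos]) simp
  have "I \<le> wr"
    unfolding I_def wr_def by (intro integral_mono int int_S) (auto simp: indicator_def)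
  then have wr_pos: "0 < wr" using I_pos by linarith
  have w_eq: "w = ennreal wr"
  proof -
    have "w = (\<integral>\<^sup>+x. ennreal (val g x) \<partial>lborel)"
      unfolding w_def ac_weight_def using AE_ennreal_val[OF g] by (intro nn_integral_cong_AE) auto
    also have "\<dots> = ennreal wr"
      unfolding wr_def by (rule nn_integral_eq_integral[OF int]) simp
    finally show ?thesis .
  qed
  define N where "N = density lborel (\<lambda>x. ac_part g x / w)"
  have N: "ennreal (1 - cdf N 0) = ennreal (I / wr)"
  proof -
    have "emeasure N {..0} = (\<integral>\<^sup>+x. ac_part g x / w * indicator {..0} x \<partial>lborel)"
      unfolding N_def by (rule emeasure_density) simp_all
    also have "\<dots> = (\<integral>\<^sup>+x. ennreal (indicator {..0} x * val g x / wr) \<partial>lborel)"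
      using AE_ennreal_val[OF g] wr_pos
      by (intro nn_integral_cong_AE) (auto simp: w_eq indicator_def divide_ennreal elim!: eventually_mono)
    also have "\<dots> = ennreal ((\<integral>x. indicator {..0} x * val g x \<partial>lborel) / wr)"
      using wr_pos int_S[of "{..0}"] by (subst nn_integral_eq_integral) auto
    finally have "cdf N 0 = (\<integral>x. indicator {..0} x * val g x \<partial>lborel) / wr"
      using wr_pos by (simp add: cdf_def measure_def)
    moreover have "wr = (\<integral>x. indicator {..0} x * val g x \<partial>lborel) + I"
    proof -
      have "wr = (\<integral>x. indicator {..0} x * val g x + indicator {0..} x * val g x \<partial>lborel)"
        unfolding wr_def
      proof (rule integral_cong_AE)
        show "AE x in lborel. val g x = indicator {..0} x * val g x + indicator {0..} x * val g x"
          using AE_lborel_singleton[of 0] by eventually_elim (auto simp: indicator_def)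
      qed simp_all
      then show ?thesis
        by (simp add: I_def int_S)
    qed
    ultimately have "cdf N 0 = (wr - I) / wr"
      by simp
    then show ?thesis
      using wr_pos by (simp add: diff_divide_distrib)
  qed
  \<comment> \<open>The normalizing factors of the density and of its restriction combine to \<open>I\<close>.\<close>
  define P where "P = pos_restriction (\<lambda>x. ac_part g x / w)"
  have P: "P x = indicator {0..} x * ac_part g x / ennreal I" for x
  proof -
    have "P x = indicator {0..} x * ac_part g x * (inverse (ennreal wr) * inverse (ennreal (I / wr)))"
      using N by (simp add: P_def pos_restriction_def N_def w_eq divide_ennreal_def mult_ac)
    also have "inverse (ennreal wr) * inverse (ennreal (I / wr)) = inverse (ennreal I)"
      using wr_pos I_pos by (simp add: inverse_ennreal inverse_eq_divide flip: ennreal_mult)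
    finally show ?thesis by (simp add: divide_ennreal_def)
  qed
  have sub: "subexponential (GDensity 0 P)"
    using w by (simp add: weakly_subexponential_def weakly_subexponential_density_def P_def w_def)
  define T where "T x = (\<integral>\<^sup>+y. P (x - y) * P y \<partial>lborel)" for x
  have "tail_equiv T (\<lambda>x. 2 * P x)"
  proof -
    have "ac_part (gpow (GDensity 0 P) 2) = T"
      by (simp add: numeral_2_eq_2 gconv_def T_def fun_eq_iff)
    then show ?thesis using sub by (simp add: subexponential_def)
  qed
  then have T: "\<forall>\<^sub>F x in at_top. 0 < T x \<and> T x < \<top> \<and> 0 < 2 * P x \<and> 2 * P x < \<top>"
    "((\<lambda>x. enn2real (T x) / enn2real (2 * P x)) \<longlongrightarrow> 1) at_top"
    unfolding tail_equiv_val by blast+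
  have shift: "((\<lambda>x. val g (x - y) / val g x) \<longlongrightarrow> 1) at_top" for y
  proof (rule shift_ratio_tendsto[OF _ pos])
    fix y :: real assume "y > 0"
    then have "tail_equiv (\<lambda>x. ac_part g (x + y) / w) (\<lambda>x. ac_part g x / w)"
      using w by (simp add: weakly_subexponential_def weakly_subexponential_density_def
        long_tailed_def w_def)
    then have "((\<lambda>x. enn2real (ac_part g (x + y) / w) / enn2real (ac_part g x / w)) \<longlongrightarrow> 1) at_top"
      unfolding tail_equiv_val by blast
    moreover have "enn2real (z / w) = enn2real z / wr" for z
      using wr_pos by (cases z) (simp_all add: w_eq divide_ennreal ennreal_top_divide)
    ultimately show "((\<lambda>x. val g (x + y) / val g x) \<longlongrightarrow> 1) at_top"
      using wr_pos by (simp add: val_def)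
  qed
  show ?thesis
  proof
    show "val g \<in> borel_measurable borel" by measurable
    show "\<exists>K>0. \<forall>\<^sub>F x in at_top. \<forall>t\<ge>x. val g t \<le> K * val g x"
      using ani_sup[OF ani, of 2] by (intro exI[of _ 2]) simp
    fix \<epsilon> :: real assume "0 < \<epsilon>"
    \<comment> \<open>The bounds for the whole integral and for its two ends differ by at most \<open>4 * \<eta> * (1 + I) * H x\<close>.\<close>
    define \<eta> where "\<eta> = min (1 / 2) (\<epsilon> / (6 * (1 + I)))"
    have "\<eta> \<le> \<epsilon> / (6 * (1 + I))"
      by (simp add: \<eta>_def)
    then have "\<eta> * (6 * (1 + I)) \<le> \<epsilon>"
      using I_pos by (subst (asm) pos_le_divide_eq) simp_all
    then have \<eta>: "0 < \<eta>" "\<eta> < 1" "6 * \<eta> * (1 + I) \<le> \<epsilon>"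
      using \<open>0 < \<epsilon>\<close> I_pos by (auto simp: \<eta>_def min_def algebra_simps)
    define J where "J A = (\<integral>y. indicator {0..A} y * val g y \<partial>lborel)" for A
    have "(J \<longlongrightarrow> I) at_top"
    proof -
      have "((\<lambda>A. \<integral>y. indicator {..A} y *\<^sub>R (indicator {0..} y * val g y) \<partial>lborel) \<longlongrightarrow> I) at_top"
        unfolding I_def by (rule tendsto_integral_at_top) (simp_all add: int_S)
      moreover have "indicator {..A} y *\<^sub>R (indicator {0..} y * val g y) = indicator {0..A} y * val g y"
        for A y :: real
        by (auto simp: indicator_def)
      ultimately show ?thesis by (simp only: J_def[abs_def])
    qed
    then have "\<forall>\<^sub>F A in at_top. I - \<eta> < J A"
      by (rule order_tendstoD) (use \<eta> in simp)
    then show "\<forall>\<^sub>F A in at_top. \<forall>\<^sub>F x in at_top.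
      (\<integral>\<^sup>+y. indicator {A<..<x - A} y * ennreal (val g (x - y) * val g y) \<partial>lborel)
        \<le> ennreal (\<epsilon> * val g x)"
      using eventually_ge_at_top[of 0]
    proof eventually_elim
      case (elim A)
      let ?f = "\<lambda>x y. ennreal (val g (x - y) * val g y)"
      let ?mid = "\<lambda>x. \<integral>\<^sup>+y. indicator {A<..<x - A} y * ?f x y \<partial>lborel"
      let ?low = "\<lambda>x. \<integral>\<^sup>+y. indicator {0..A} y * ?f x y \<partial>lborel"
      have low: "\<forall>\<^sub>F x in at_top. ennreal (((1 - \<eta>) * J A - \<eta>) * val g x)
          \<le> (\<integral>\<^sup>+y. indicator {0..A} y * ?f x y \<partial>lborel)"
        unfolding J_def
      proof (rule nn_conv_lower)
        show "\<forall>\<^sub>F x in at_top. (1 - \<eta>) * val g x \<le> val g (x - y)" for y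
        proof -
          have "\<forall>\<^sub>F x in at_top. 1 - \<eta> < val g (x - y) / val g x"
            by (rule order_tendstoD[OF shift]) (use \<eta> in simp)
          with pos show ?thesis
            by eventually_elim (simp add: pos_less_divide_eq)
        qed
      qed (use \<eta> pos int in simp_all)
      have "\<forall>\<^sub>F x in at_top. enn2real (T x) / enn2real (2 * P x) < 1 + \<eta>"
        by (rule order_tendstoD[OF T(2)]) (use \<eta> in simp)
      then show ?case
        using low T(1) pos fin eventually_gt_at_top[of "2 * A"]
      proof eventually_elim
        case x: (elim x)
        have "x \<ge> 0" using x \<open>0 \<le> A\<close> by simp
        have le: "ennreal (val g z) \<le> ac_part g z" for z
          by (cases "ac_part g z") (simp_all add: val_def)
        \<comment> \<open>\<open>P\<close> is the density over \<open>I\<close> on the positive half-line, so its self-convolution carries the factor \<open>1 / I\<^sup>2\<close>.\<close>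
        have TP: "T x \<le> ennreal (2 * (1 + \<eta>) * val g x / I)"
        proof -
          have "P x = ennreal (val g x / I)"
            using I_pos \<open>x \<ge> 0\<close> x by (simp add: P ennreal_val[symmetric] divide_ennreal)
          then have "2 * P x = ennreal 2 * ennreal (val g x / I)"
            by simp
          also have "\<dots> = ennreal (2 * val g x / I)"
            using I_pos by (subst ennreal_mult[symmetric]) simp_all
          finally have "2 * P x = ennreal (2 * val g x / I)" .
          then have eq: "enn2real (2 * P x) = 2 * val g x / I"
            using I_pos by simp
          have "0 < 2 * val g x / I"
            using x I_pos by simp
          from x(1)[unfolded eq pos_divide_less_eq[OF this]]
          have "enn2real (T x) \<le> 2 * (1 + \<eta>) * val g x / I"
            by (simp add: algebra_simps)
          then have "ennreal (enn2real (T x)) \<le> ennreal (2 * (1 + \<eta>) * val g x / I)"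
            by (rule ennreal_leI)
          then show ?thesis using x by simp
        qed
        have "(\<integral>\<^sup>+y. indicator {0..x} y * ?f x y \<partial>lborel) \<le> (\<integral>\<^sup>+y. ennreal (I * I) * (P (x - y) * P y) \<partial>lborel)"
        proof (rule nn_integral_mono)
          fix y
          have "?f x y \<le> ennreal (I * I) * (P (x - y) * P y)" if "0 \<le> y" "y \<le> x"
          proof -
            have G: "ac_part g z = ennreal I * P z" if "0 \<le> z" for z
              using that I_pos
              by (simp add: P ennreal_times_divide mult.commute[of "ennreal I"] ennreal_mult_divide_eq)
            have "?f x y \<le> ac_part g (x - y) * ac_part g y"
              by (simp add: ennreal_mult mult_mono le)
            also have "\<dots> = ennreal (I * I) * (P (x - y) * P y)"
              using that I_pos G[of y] G[of "x - y"] by (simp add: ennreal_mult mult_ac)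
            finally show ?thesis .
          qed
          then show "indicator {0..x} y * ?f x y \<le> ennreal (I * I) * (P (x - y) * P y)"
            by (simp add: indicator_def)
        qed
        also have "\<dots> = ennreal (I * I) * T x"
        proof -
          have "P \<in> borel_measurable borel"
            unfolding P[abs_def] by measurable
          then show ?thesis
            unfolding T_def by (intro nn_integral_cmult) simp
        qed
        also have "\<dots> \<le> ennreal (I * I) * ennreal (2 * (1 + \<eta>) * val g x / I)"
          by (intro mult_left_mono TP) simp
        also have "\<dots> = ennreal (2 * (1 + \<eta>) * I * val g x)"
        proof -
          have "I * I * (2 * (1 + \<eta>) * val g x / I) = 2 * (1 + \<eta>) * I * val g x"
            using I_pos by simp
          then show ?thesis
            using I_pos \<eta> by (subst ennreal_mult[symmetric]) (simp_all only:, simp_all)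
        qed
        finally have upper: "(\<integral>\<^sup>+y. indicator {0..x} y * ?f x y \<partial>lborel)
          \<le> ennreal (2 * (1 + \<eta>) * I * val g x)" .
        have "(\<integral>\<^sup>+y. indicator {0..A} y * ?f x y \<partial>lborel) + (\<integral>\<^sup>+y. indicator {x - A..x} y * ?f x y \<partial>lborel) + ?mid x
          = (\<integral>\<^sup>+y. indicator {0..A} y * ?f x y + indicator {x - A..x} y * ?f x y + indicator {A<..<x - A} y * ?f x y \<partial>lborel)"
          by (simp add: nn_integral_add)
        also have "\<dots> = (\<integral>\<^sup>+y. indicator {0..x} y * ?f x y \<partial>lborel)"
          using x \<open>0 \<le> A\<close> by (intro nn_integral_cong) (auto simp: indicator_def)
        also have "(\<integral>\<^sup>+y. indicator {x - A..x} y * ?f x y \<partial>lborel) = (\<integral>\<^sup>+y. indicator {0..A} y * ?f x y \<partial>lborel)"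
          by (subst nn_integral_real_affine[where c="-1" and t=x])
            (auto simp: indicator_def mult_ac intro!: nn_integral_cong)
        finally have total: "?low x + ?low x + ?mid x \<le> ennreal (2 * (1 + \<eta>) * I * val g x)"
          using upper by simp
        define l where "l = ((1 - \<eta>) * J A - \<eta>) * val g x"
        have "ennreal l \<le> ?low x"
          unfolding l_def by (rule x(2))
        then have "ennreal l + ennreal l + ?mid x \<le> ?low x + ?low x + ?mid x"
          by (intro add_mono order_refl)
        from this total have le2: "ennreal l + ennreal l + ?mid x \<le> ennreal (2 * (1 + \<eta>) * I * val g x)"
          by (rule order_trans)
        have "?mid x \<le> ennreal l + ennreal l + ?mid x"
          by simp
        also note le2
        finally have "?mid x < \<top>"
          by (rule le_less_trans) simp
        then obtain m where m: "?mid x = ennreal m" "0 \<le> m"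
          by (cases "?mid x") auto
        have "l + l + m \<le> 2 * (1 + \<eta>) * I * val g x"
        proof (cases "0 \<le> l")
          case True
          then have "ennreal (l + l + m) \<le> ennreal (2 * (1 + \<eta>) * I * val g x)"
            using le2 m by (simp only: ennreal_plus add_nonneg_nonneg)
          then show ?thesis
            using I_pos \<eta> by (subst (asm) ennreal_le_iff) auto
        next
          case False
          have "ennreal m \<le> ennreal (2 * (1 + \<eta>) * I * val g x)"
            using le2 m False by (simp add: ennreal_neg)
          then show ?thesis
            using I_pos \<eta> False by (subst (asm) ennreal_le_iff) auto
        qed
        then have "m \<le> (2 * (1 + \<eta>) * I - 2 * ((1 - \<eta>) * J A - \<eta>)) * val g x"
          by (simp add: l_def algebra_simps)
        also have "\<dots> \<le> \<epsilon> * val g x"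
        proof (rule mult_right_mono)
          have "(1 - \<eta>) * (I - \<eta>) \<le> (1 - \<eta>) * J A"
            using elim \<eta> by (intro mult_left_mono) auto
          moreover have "I - \<eta> - \<eta> * I \<le> (1 - \<eta>) * (I - \<eta>)"
            using \<eta> by (simp add: algebra_simps)
          ultimately have "I - \<eta> - \<eta> * I \<le> (1 - \<eta>) * J A"
            by linarith
          moreover have "0 \<le> \<eta> * I"
            using \<eta> I_pos by simp
          ultimately show "2 * (1 + \<eta>) * I - 2 * ((1 - \<eta>) * J A - \<eta>) \<le> \<epsilon>"
            using \<eta> by (simp add: algebra_simps)
        qed simp
        finally show ?case
          unfolding m(1) by (rule ennreal_leI)
      qed
    qed
  qed (use pos shift in simp_all)
qed


lemma (in subexp_tail) shift_insensitive_ratio: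
  assumes "bigO a" and shift: "\<And>y. ((\<lambda>x. val a (x - y) / val a x) \<longlongrightarrow> 1) at_top"
    and pos: "\<forall>\<^sub>F x in at_top. 0 < val a x"
  shows "shift_insensitive (ratio a)"
  unfolding shift_insensitive_def
proof
  fix y
  obtain C where C: "C > 0" "\<forall>\<^sub>F x in at_top. ratio a x \<le> C"
    using bigO_ratio[OF assms(1)] by blast
  define \<rho> where "\<rho> x = (val a (x - y) / val a x) / (H (x - y) / H x)" for x
  have "(\<rho> \<longlongrightarrow> 1 / 1) at_top"
    unfolding \<rho>_def[abs_def] by (intro tendsto_divide shift H_shift) simp
  then have "((\<lambda>x. C * \<bar>\<rho> x - 1\<bar>) \<longlongrightarrow> C * \<bar>1 / 1 - 1\<bar>) at_top"
    by (intro tendsto_intros)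
  then have lim: "((\<lambda>x. C * \<bar>\<rho> x - 1\<bar>) \<longlongrightarrow> 0) at_top"
    by simp
  have "\<forall>\<^sub>F x in at_top. norm (ratio a (x - y) - ratio a x) \<le> C * \<bar>\<rho> x - 1\<bar>"
    using C(2) pos H_pos eventually_compose_filterlim[OF H_pos filterlim_shift[of y]]
  proof eventually_elim
    case (elim x)
    have "ratio a (x - y) - ratio a x = ratio a x * (\<rho> x - 1)"
      using elim by (simp add: \<rho>_def ratio_def field_simps)
    then have "norm (ratio a (x - y) - ratio a x) = ratio a x * \<bar>\<rho> x - 1\<bar>"
      by (simp add: abs_mult ratio_nonneg)
    also have "\<dots> \<le> C * \<bar>\<rho> x - 1\<bar>"
      using elim by (intro mult_right_mono) auto
    finally show ?case .
  qed
  from Lim_null_comparison[OF this lim]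
  show "((\<lambda>x. ratio a (x - y) - ratio a x) \<longlongrightarrow> 0) at_top" .
qed

lemma (in subexp_tail) asymp_decreasing_ratio:
  assumes "bigO a" and ani: "ani a"
  shows "asymp_decreasing (ratio a)"
  unfolding asymp_decreasing_def
proof (intro allI impI)
  fix d \<epsilon> :: real assume "0 \<le> d" "0 < \<epsilon>"
  obtain C where C: "C > 0" "\<forall>\<^sub>F x in at_top. ratio a x \<le> C"
    using bigO_ratio[OF assms(1)] by blast
  define c where "c = 1 + \<epsilon> / (2 * C)"
  have c: "1 < c" using \<open>0 < \<epsilon>\<close> C(1) by (simp add: c_def)
  have "((\<lambda>x. c * (H x / H (x + d)) * 1) \<longlongrightarrow> c * 1 * 1) at_top"
    by (intro tendsto_intros H_shift_inv)
  then have "\<forall>\<^sub>F x in at_top. c * (H x / H (x + d)) * 1 < 1 + \<epsilon> / C"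
    by (rule order_tendstoD) (use \<open>0 < \<epsilon>\<close> C(1) in \<open>simp add: c_def field_simps\<close>)
  then show "\<forall>\<^sub>F x in at_top. ratio a (x + d) \<le> ratio a x + \<epsilon>"
    using ani_sup[OF ani c] C(2) H_pos eventually_compose_filterlim[OF H_pos filterlim_shift'[of d]]
  proof eventually_elim
    case (elim x)
    have "ratio a (x + d) \<le> c * val a x / H (x + d)"
      unfolding ratio_def using elim \<open>0 \<le> d\<close> by (intro divide_right_mono) auto
    also have "\<dots> = c * (H x / H (x + d)) * 1 * ratio a x"
      using elim by (simp add: ratio_def)
    also have "\<dots> \<le> (1 + \<epsilon> / C) * ratio a x"
      using elim ratio_nonneg[of a x] by (intro mult_right_mono) auto
    also have "\<dots> \<le> ratio a x + \<epsilon>"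
    proof -
      have "\<epsilon> / C * ratio a x \<le> \<epsilon> / C * C"
        using elim \<open>0 < \<epsilon>\<close> C(1) by (intro mult_left_mono) auto
      then show ?thesis using C(1) by (simp add: algebra_simps)
    qed
    finally show ?case .
  qed
qed

text \<open>
  An a.n.i. function does not decrease noticeably under shifts to the left, and an a.n.i. factor \<open>b\<close>
  charges the positive half-line.
\<close>

lemma (in subexp_tail) bigO_of_ani_factor:
  assumes a: "prob_gdensity a" "ani a" and b: "prob_gdensity b" "ani b"
    and H: "\<forall>\<^sub>F x in at_top. ac_part (gconv a b) x = ennreal (H x)"
  shows "bigO a"
proof (rule bigO_of_factor[OF a(1) b(1), of "{0..}"])
  show "\<forall>\<^sub>F x in at_top. val a x \<le> 2 * val a (x - y)" if "y \<in> {0..}" for y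
  proof -
    have "\<forall>\<^sub>F x in at_top. \<forall>t\<ge>x. val a t \<le> 2 * val a x"
      by (rule ani_sup[OF a(2)]) simp
    from eventually_compose_filterlim[OF this filterlim_shift[of y]]
    show ?thesis
      using that by (auto elim!: eventually_mono)
  qed
  have "\<forall>\<^sub>F x in at_top. 0 < val b x"
    using ani_finite[OF b(2)] by eventually_elim (simp add: val_def enn2real_positive_iff)
  then have "0 < (\<integral>y. indicator {0..} y * val b y \<partial>lborel)"
    by (intro integral_pos_of_eventually_pos val_integral(1)[OF b(1)]) simp_all
  then show "0 < enn2real (atom b) + (\<integral>y. indicator {0..} y * val b y \<partial>lborel)"
    by (simp add: add_nonneg_pos)
qed (use ani_finite[OF a(2)] H in simp_all)

section \<open>The convolution root\<close>

theorem theorem3p13: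
  fixes p q :: real and f :: "real \<Rightarrow> real" and n :: nat
  assumes "0 \<le> p" and "0 \<le> q" and "p + q = 1"
    and "f \<in> borel_measurable borel" and "\<And>x. 0 \<le> f x"
    and "prob_space (density lborel (\<lambda>x. ennreal (f x)))"
    and "1 \<le> n"
    and "weakly_subexponential (gpow (gmix p q f) n)"
    and "ani (gpow (gmix p q f) n)"
    and "(\<forall>k\<in>{1..n - 1}. ani (gpow (gmix p q f) k)) \<or> long_tailed (gmix p q f)"
  shows "subexponential (gmix p q f)"
proof -
  define h where "h = gmix p q f"
  define H where "H = val (gpow h n)"
  have h: "prob_gdensity h"
  proof -
    note [measurable] = assms(4)
    have "(\<integral>\<^sup>+x. ennreal (f x) \<partial>lborel) = 1"
      using prob_space.emeasure_space_1[OF assms(6)] by (simp add: emeasure_density)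
    then have "ac_weight h = ennreal q"
      using assms(2) by (simp add: h_def gmix_eq ac_weight_def nn_integral_cmult)
    then show ?thesis
      using assms(1-3) by (simp add: prob_gdensity_def h_def gmix_def flip: ennreal_plus)
  qed
  have gp: "prob_gdensity (gpow h k)" for k
    by (rule prob_gdensity_gpow[OF h])
  have ani_n: "ani (gpow h n)"
    using assms(9) by (simp add: h_def)
  interpret subexp_tail H
    unfolding H_def by (rule subexp_tail_val[OF gp _ ani_n]) (use assms(8) in \<open>simp add: h_def\<close>)
  have H: "\<forall>\<^sub>F x in at_top. ac_part (gpow h n) x = ennreal (H x)"
    using ani_finite[OF ani_n] by eventually_elim (simp add: H_def ennreal_val)
  have ratio_n: "\<forall>\<^sub>F x in at_top. ratio (gpow h n) x = 1"
    using H_pos by eventually_elim (simp add: ratio_def flip: H_def)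
  have bigO_n: "bigO (gpow h n)"
    unfolding bigO_def using H by (intro exI[of _ 1]) (auto elim: eventually_mono)
  obtain m where n: "n = Suc m"
    using \<open>1 \<le> n\<close> by (cases n) auto
  have H1: "\<forall>\<^sub>F x in at_top. ac_part (gconv h (gpow h m)) x = ennreal (H x)"
    and H2: "\<forall>\<^sub>F x in at_top. ac_part (gconv (gpow h m) h) x = ennreal (H x)"
    using H by (simp_all add: n gconv_commute[OF h gp])
  \<comment> \<open>The case \<open>n = 1\<close> is separate because its range of \<open>k\<close> is empty.\<close>
  have step: "bigO h \<and> shift_insensitive (ratio h)"
  proof -
    consider "n = 1" | "long_tailed h" | "m \<ge> 1" "ani h" "ani (gpow h m)"
    proof (cases "m = 0")
      case False
      then have "1 \<in> {1..n - 1}" "m \<in> {1..n - 1}" by (auto simp: n)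
      then show ?thesis
        using assms(10) False that(2,3) gpow_1[of h] unfolding h_def by fastforce
    qed (simp add: n)
    then show ?thesis
    proof cases
      case 1
      then have "gpow h n = h"
        by (simp only: One_nat_def gpow_1)
      then show ?thesis
        using bigO_n ratio_n by (auto intro!: shift_insensitive_of_convergent[of _ 1] tendsto_eventually)
    next
      case 2
      note lt = long_tailed_val[OF 2]
      have pos: "\<forall>\<^sub>F x in at_top. 0 < val h x"
        using lt(1) by eventually_elim (simp add: val_def enn2real_positive_iff)
      have "bigO h"
      proof (rule bigO_of_factor[OF h gp _ lt(1) _ _ H1, of UNIV])
        show "\<forall>\<^sub>F x in at_top. val h x \<le> 2 * val h (x - y)" for y
        proof -
          have "\<forall>\<^sub>F x in at_top. 1 / 2 < val h (x - y) / val h x"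
            by (rule order_tendstoD[OF lt(2)]) simp
          with pos show ?thesis
            by eventually_elim (simp add: pos_less_divide_eq)
        qed
      qed (simp_all add: val_integral(2)[OF gp])
      then show ?thesis
        using shift_insensitive_ratio[OF _ lt(2) pos] by blast
    next
      case 3
      have O1: "bigO h"
        by (rule bigO_of_ani_factor[OF h 3(2) gp 3(3) H1])
      have O2: "bigO (gpow h m)"
        by (rule bigO_of_ani_factor[OF gp 3(3) h 3(2) H2])
      have "gconv h (gpow h m) = gpow h n"
        by (simp add: n gconv_commute[OF h gp])
      then have lim: "(ratio (gconv h (gpow h m)) \<longlongrightarrow> 1) at_top"
        using ratio_n by (simp add: tendsto_eventually)
      have "\<forall>\<^sub>F x in at_top. 0 < val (gpow h m) x"
        using ani_finite[OF 3(3)] by eventually_elim (simp add: val_def enn2real_positive_iff)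
      then have "0 < (\<integral>y. indicator {0..} y * val (gpow h m) y \<partial>lborel)"
        by (intro integral_pos_of_eventually_pos val_integral(1)[OF gp]) simp_all
      also have "\<dots> \<le> (\<integral>y. val (gpow h m) y \<partial>lborel)"
        using integrable_mult_indicator[OF _ val_integral(1)[OF gp], of "{0..}" m] val_integral(1)[OF gp]
        by (intro integral_mono) (auto simp: indicator_def)
      finally show ?thesis
        using shift_insensitive_of_asymp_decreasing[OF h O1 asymp_decreasing_ratio[OF O1 3(2)] gp O2 asymp_decreasing_ratio[OF O2 3(3)] lim] O1
        by blast
    qed
  qed
  then have O: "bigO h" and shift_insensitive: "shift_insensitive (ratio h)" by auto
  \<comment> \<open>At \<open>k = n\<close> the ratio is \<open>1\<close>, which identifies the limit of \<open>ratio h\<close>.\<close>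
  have pow: "bigO (gpow h k) \<and> ((\<lambda>x. ratio (gpow h k) x - real k * ratio h x) \<longlongrightarrow> 0) at_top" for k
  proof (induction k)
    case 0
    have "\<forall>\<^sub>F x in at_top. ac_part (gpow h 0) x \<le> ennreal (1 * H x)" by simp
    then show ?case
      unfolding bigO_def by (auto simp: ratio_def val_def intro!: exI[of _ 1])
  next
    case (Suc k)
    then have k: "bigO (gpow h k)" "((\<lambda>x. ratio (gpow h k) x - real k * ratio h x) \<longlongrightarrow> 0) at_top"
      by auto
    note c = ratio_gconv_of_shift_insensitive[OF gp k(1) shift_insensitive_of_cmult[OF shift_insensitive k(2)] h O shift_insensitive]
    from c(1) tendsto_add[OF c(2) k(2)] show ?case
      by (simp add: algebra_simps)
  qed
  have ratio_h: "(ratio h \<longlongrightarrow> 1 / real n) at_top"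
  proof -
    have "((\<lambda>x. (ratio (gpow h n) x - (ratio (gpow h n) x - real n * ratio h x)) / real n)
        \<longlongrightarrow> (1 - 0) / real n) at_top"
      using pow[of n] ratio_n \<open>1 \<le> n\<close> by (intro tendsto_intros) (auto intro: tendsto_eventually)
    then show ?thesis using \<open>1 \<le> n\<close> by simp
  qed
  have ratio_2: "(ratio (gpow h 2) \<longlongrightarrow> 2 / real n) at_top"
    using tendsto_add[OF conjunct2[OF pow[of 2]] tendsto_mult[OF tendsto_const[of 2] ratio_h]] by simp
  have n_pos: "0 < 1 / real n" "0 < 2 / real n" using \<open>1 \<le> n\<close> by simp_all
  have val_pos: "\<forall>\<^sub>F x in at_top. 0 < ac_part g x \<and> ac_part g x < \<top>"
    if "bigO g" "(ratio g \<longlongrightarrow> c) at_top" "0 < c" for g c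
    using order_tendstoD(1)[OF that(2,3)] bigO_finite[OF that(1)]
  proof eventually_elim
    case (elim x)
    then have "ac_part g x \<noteq> 0" by (auto simp: ratio_def val_def)
    then show ?case using elim by (simp add: zero_less_iff_neq_zero)
  qed
  have fin: "\<forall>\<^sub>F x in at_top. 0 < ac_part h x \<and> ac_part h x < \<top>"
    by (rule val_pos[OF O ratio_h n_pos(1)])
  have fin2: "\<forall>\<^sub>F x in at_top. 0 < ac_part (gpow h 2) x \<and> ac_part (gpow h 2) x < \<top>"
    by (rule val_pos[OF _ ratio_2 n_pos(2)]) (use pow in blast)
  have "long_tailed h"
    unfolding long_tailed_def
  proof (intro conjI allI impI)
    obtain X where "\<And>x. x \<ge> X \<Longrightarrow> 0 < ac_part h x"
      using fin by (auto simp: eventually_at_top_linorder)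
    then show "\<exists>x0>0. \<forall>x\<ge>x0. 0 < ac_part h x"
      by (intro exI[of _ "max 1 X"]) auto
    fix y :: real assume "0 < y"
    show "tail_equiv (\<lambda>x. ac_part h (x + y)) (ac_part h)"
      unfolding tail_equiv_val
    proof
      show "\<forall>\<^sub>F x in at_top. 0 < ac_part h (x + y) \<and> ac_part h (x + y) < \<top> \<and>
          0 < ac_part h x \<and> ac_part h x < \<top>"
        using fin eventually_compose_filterlim[OF fin filterlim_shift'[of y]]
        by eventually_elim simp
      have "((\<lambda>x. ratio h (x + y) / ratio h x * (H (x - (- y)) / H x))
          \<longlongrightarrow> (1 / real n) / (1 / real n) * 1) at_top"
        using n_pos by (intro tendsto_intros H_shift ratio_h filterlim_compose[OF ratio_h filterlim_shift']) auto
      then have lim: "((\<lambda>x. ratio h (x + y) / ratio h x * (H (x - (- y)) / H x)) \<longlongrightarrow> 1) at_top"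
        using \<open>1 \<le> n\<close> by simp
      have "\<forall>\<^sub>F x in at_top. ratio h (x + y) / ratio h x * (H (x - (- y)) / H x)
          = enn2real (ac_part h (x + y)) / enn2real (ac_part h x)"
        using H_pos eventually_compose_filterlim[OF H_pos filterlim_shift'[of y]]
        by eventually_elim (simp add: ratio_def val_def)
      from tendsto_cong[OF this] lim
      show "((\<lambda>x. enn2real (ac_part h (x + y)) / enn2real (ac_part h x)) \<longlongrightarrow> 1) at_top"
        by simp
    qed
  qed
  moreover have "tail_equiv (ac_part (gpow h 2)) (\<lambda>x. 2 * ac_part h x)"
    unfolding tail_equiv_val
  proof
    show "\<forall>\<^sub>F x in at_top. 0 < ac_part (gpow h 2) x \<and> ac_part (gpow h 2) x < \<top> \<and>
        0 < 2 * ac_part h x \<and> 2 * ac_part h x < \<top>"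
      using fin fin2
      by eventually_elim (simp add: ennreal_zero_less_mult_iff ennreal_mult_less_top)
    have "((\<lambda>x. ratio (gpow h 2) x / (2 * ratio h x)) \<longlongrightarrow> (2 / real n) / (2 * (1 / real n))) at_top"
      using n_pos by (intro tendsto_intros ratio_2 ratio_h) auto
    then have lim: "((\<lambda>x. ratio (gpow h 2) x / (2 * ratio h x)) \<longlongrightarrow> 1) at_top"
      using \<open>1 \<le> n\<close> by simp
    have "\<forall>\<^sub>F x in at_top. ratio (gpow h 2) x / (2 * ratio h x)
        = enn2real (ac_part (gpow h 2) x) / enn2real (2 * ac_part h x)"
      using H_pos by eventually_elim (simp add: ratio_def val_def enn2real_mult)
    from tendsto_cong[OF this] lim
    show "((\<lambda>x. enn2real (ac_part (gpow h 2) x) / enn2real (2 * ac_part h x)) \<longlongrightarrow> 1) at_top"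
      by simp
  qed
  ultimately show ?thesis
    by (simp add: subexponential_def h_def)
qed

end
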